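(* Fix $T>0$ and $Q\in\mathbb{R}^n$. There exists a minimax Mather measure $\theta$ for $g_Q=g_Q^T$ which is supported in a single point; that is, there exists $x^*\in\mathbb{T}^n$ such that $$g_Q^T(\delta_{x^*})=\sup_{\theta}g_Q^T(\theta),$$ the supremum being over all Borel probability measures $\theta$ on $\mathbb{T}^n$.
   Context: $\mathbb{T}^n$ is the $n$-torus $\mathbb{R}^n/\mathbb{Z}^n$. The Lagrangian $L:\mathbb{T}^n\times\mathbb{R}^n\to\mathbb{R}$ is smooth, strictly convex in $v$ with $D^2_{vv}L(x,v)\ge\gamma>0$ for some constant $\gamma$, and coercive: $\lim_{|v|\to\infty}L(x,v)/|v|=\infty$. For a Borel probability measure $\theta$ on $\mathbb{T}^n$, $T>0$ and $Q\in\mathbb{R}^n$, $\Pi(T,\theta,Q)$ denotes the set of (non-negative Borel) measures $\rho$ on $[0,T]\times\mathbb{T}^n\times\mathbb{R}^n$ (coordinates $(t,x,v)$) such that $$\int_0^T\int_{\mathbb{T}^n\times\mathbb{R}^n}\big(\varphi_t(x,t)+v\cdot D_x\varphi(x,t)\big)\,d\rho=\int_{\mathbb{T}^n}\big(\varphi(x,T)-\varphi(x,0)\big)\,d\theta(x)$$ for all smooth $\varphi(x,t)$, $x\in\mathbb{T}^n$, $t\in[0,T]$, and $\int_0^T\int_{\mathbb{T}^n\times\mathbb{R}^n}v\,d\rho=Q$. Define $$g_Q^T(\theta)=\inf_{\rho\in\Pi(T,\theta,Q)}\int_0^T\int_{\mathbb{T}^n\times\mathbb{R}^n}L(x,v)\,d\rho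 .$$ A minimax Mather measure $\theta$ for $g_Q$ is a maximizer of $\theta\mapsto g_Q^T(\theta)$ over probability measures on $\mathbb{T}^n$. *)

theory Defs
  imports "HOL-Probability.Probability"
begin

definition torus_rel :: "real ^ 'n \<Rightarrow> real ^ 'n \<Rightarrow> bool" where
  "torus_rel x y \<longleftrightarrow> (\<forall>i. x $ i - y $ i \<in> \<int>)"

lemma equivp_torus_rel: "equivp torus_rel"
proof (rule equivpI)
  show "reflp torus_rel"
    by (simp add: reflp_def torus_rel_def)
  show "symp torus_rel"
    unfolding symp_def torus_rel_def by (metis Ints_minus minus_diff_eq)
  show "transp torus_rel"
  proof (rule transpI)
    fix x y z :: "real ^ 'n"
    assume "torus_rel x y" "torus_rel y z"
    then have "(x $ i - y $ i) + (y $ i - z $ i) \<in> \<int>" for i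
      unfolding torus_rel_def by (blast intro: Ints_add)
    then show "torus_rel x z"
      by (simp add: torus_rel_def)
  qed
qed

quotient_type 'n torus = "real ^ 'n" / torus_rel
  by (rule equivp_torus_rel)

text \<open>The torus carries the quotient topology; its Borel sigma-algebra and those of
  its products with Euclidean spaces are the ones generated by the open sets.\<close>

instantiation torus :: (finite) topological_space
begin

definition open_torus :: "'a torus set \<Rightarrow> bool" where
  "open_torus U \<longleftrightarrow> open (abs_torus -` U)"

instance
proof
  show "open (UNIV :: 'a torus set)"
    by (simp add: open_torus_def)
  show "open (S \<inter> U)" if "open S" "open U" for S U :: "'a torus set"
    using that by (simp add: open_torus_def vimage_Int open_Int)
  show "open (\<Union>K)" if "\<forall>S\<in>K. open S" for K :: "'a torus set set"
    using that by (auto simp: open_torus_def vimage_Union)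
qed

end

primrec Ck :: "nat \<Rightarrow> ('a::euclidean_space \<Rightarrow> 'b::real_normed_vector) \<Rightarrow> bool" where
  "Ck 0 f \<longleftrightarrow> continuous_on UNIV f"
| "Ck (Suc k) f \<longleftrightarrow> (\<forall>x. f differentiable (at x)) \<and>
     (\<forall>v. Ck k (\<lambda>x. frechet_derivative f (at x) v))"

definition smooth :: "('a::euclidean_space \<Rightarrow> 'b::real_normed_vector) \<Rightarrow> bool" where
  "smooth f \<longleftrightarrow> (\<forall>k. Ck k f)"

text \<open>The gradient of a function on the torus is that of its periodic lift, which does not
  depend on the representative.\<close>

definition torus_grad :: "('n::finite torus \<Rightarrow> real) \<Rightarrow> 'n torus \<Rightarrow> real ^ 'n" where
  "torus_grad f x =
     (\<chi> i. frechet_derivative (\<lambda>y. f (abs_torus y)) (at (rep_torus x)) (axis i 1))"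

text \<open>\<open>D2 f v w z\<close> is the second derivative of \<open>f\<close> at \<open>v\<close>, as a bilinear form in \<open>w\<close> and \<open>z\<close>.\<close>

definition D2 :: "('a::euclidean_space \<Rightarrow> real) \<Rightarrow> 'a \<Rightarrow> 'a \<Rightarrow> 'a \<Rightarrow> real" where
  "D2 f v w z = frechet_derivative (\<lambda>u. frechet_derivative f (at u) z) (at v) w"

definition strictly_convex :: "('a::real_vector \<Rightarrow> real) \<Rightarrow> bool" where
  "strictly_convex f \<longleftrightarrow> (\<forall>u v s. u \<noteq> v \<longrightarrow> 0 < s \<longrightarrow> s < 1 \<longrightarrow>
     f ((1 - s) *\<^sub>R u + s *\<^sub>R v) < (1 - s) * f u + s * f v)"

definition lagrangian :: "('n::finite torus \<Rightarrow> real ^ 'n \<Rightarrow> real) \<Rightarrow> bool" where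
  "lagrangian L \<longleftrightarrow>
     smooth (\<lambda>(y :: real ^ 'n, v). L (abs_torus y) v) \<and>
     (\<forall>x. strictly_convex (L x)) \<and>
     (\<exists>\<gamma>>0. \<forall>x v w. D2 (L x) v w w \<ge> \<gamma> * (norm w)\<^sup>2) \<and>
     (\<forall>x. filterlim (\<lambda>v. L x v / norm v) at_top at_infinity)"

definition borel_probs :: "'a::topological_space measure set" where
  "borel_probs = {\<theta>. prob_space \<theta> \<and> sets \<theta> = sets borel}"

text \<open>The test functions are the smooth functions on \<open>\<real> \<times> \<T>\<^sup>n\<close>; only their restrictions to
  \<open>[0,T] \<times> \<T>\<^sup>n\<close> matter, and these are the smooth functions on that manifold with boundary.
  Both integral conditions include integrability, since the Bochner integral of a
  non-integrable function is \<open>0\<close> by convention. Taking \<open>\<phi> t x = t\<close> shows that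
  \<open>\<rho>\<close> has total mass \<open>T\<close>.\<close>

definition Pi_meas ::
  "real \<Rightarrow> 'n::finite torus measure \<Rightarrow> real ^ 'n \<Rightarrow> (real \<times> 'n torus \<times> (real ^ 'n)) measure set" where
  "Pi_meas T \<theta> Q = {\<rho>.
     sets \<rho> = sets (restrict_space borel ({0..T} \<times> UNIV \<times> UNIV)) \<and>
     (\<forall>\<phi> :: real \<Rightarrow> 'n torus \<Rightarrow> real. smooth (\<lambda>(t, y). \<phi> t (abs_torus y)) \<longrightarrow>
        has_bochner_integral \<rho>
          (\<lambda>(t, x, v). deriv (\<lambda>s. \<phi> s x) t + v \<bullet> torus_grad (\<phi> t) x)
          (\<integral>x. \<phi> T x - \<phi> 0 x \<partial>\<theta>)) \<and>
     has_bochner_integral \<rho> (\<lambda>(t, x, v). v) Q}"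

text \<open>The action may be \<open>+\<infinity>\<close>, so it is the extended integral, positive part minus negative part
  (\<open>ennreal\<close> maps negative reals to \<open>0\<close>). A Lagrangian is bounded below and the measures in
  \<open>Pi_meas\<close> are finite, so the subtracted term is finite.\<close>

definition action ::
  "('n::finite torus \<Rightarrow> real ^ 'n \<Rightarrow> real) \<Rightarrow> (real \<times> 'n torus \<times> (real ^ 'n)) measure \<Rightarrow> ereal" where
  "action L \<rho> =
     enn2ereal (\<integral>\<^sup>+ (t, x, v). ennreal (L x v) \<partial>\<rho>) -
     enn2ereal (\<integral>\<^sup>+ (t, x, v). ennreal (- L x v) \<partial>\<rho>)"

definition gQ ::
  "('n::finite torus \<Rightarrow> real ^ 'n \<Rightarrow> real) \<Rightarrow> real \<Rightarrow> real ^ 'n \<Rightarrow> 'n torus measure \<Rightarrow> ereal" where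
  "gQ L T Q \<theta> = (INF \<rho>\<in>Pi_meas T \<theta> Q. action L \<rho>)"

definition minimax_mather ::
  "('n::finite torus \<Rightarrow> real ^ 'n \<Rightarrow> real) \<Rightarrow> real \<Rightarrow> real ^ 'n \<Rightarrow> 'n torus measure \<Rightarrow> bool" where
  "minimax_mather L T Q \<theta> \<longleftrightarrow>
     \<theta> \<in> borel_probs \<and> (\<forall>\<theta>'\<in>borel_probs. gQ L T Q \<theta>' \<le> gQ L T Q \<theta>)"

end

theory Submission
  imports Defs
begin

text \<open>Let \<open>\<l>\<close> be the lift of \<open>L\<close> to \<open>\<real>\<^sup>n\<close>. A competitor for \<open>\<delta>\<^sub>x\<close> looks like an average of closed
  curves through \<open>x\<close> of duration \<open>T\<close>, with mean displacement \<open>Q\<close> in the universal cover. This suggests to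
  compare \<open>g\<^sub>Q\<close> with the function \<open>loop_cost T Q\<close>, the least mean cost of a finite convex combination of
  closed polygons at \<open>x\<close> with mean displacement \<open>Q\<close>. Three facts about it give the theorem.

  It attains its maximum at some point \<open>y0\<close> (\<open>loop_cost_attains_max\<close>): a combination that is good at
  \<open>x\<close> is good near \<open>x\<close>, so the function is upper semicontinuous, and the torus is compact.

  For every \<open>\<theta>\<close>, \<open>g\<^sub>Q(\<theta>)\<close> is at most this maximum (\<open>gQ_le\<close>). Indeed, one may let the mass that \<open>\<theta>\<close>
  puts near a point circulate along a nearly optimal combination of closed polygons. All mass
  returns to its initial position, so the resulting measure is admissible for \<open>\<theta>\<close>, and
  finitely many combinations suffice by compactness.

  At every point, \<open>loop_cost T Q y0\<close> is at most \<open>g\<^sub>Q(\<delta>\<^bsub>y0\<^esub>)\<close> (\<open>gQ_ge\<close>). This is a duality argument.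
  A hyperplane separating the convex hull of all pairs (displacement, cost) of closed polygons at
  \<open>y0\<close> from the values just below it has a slope \<open>p\<close>, and passing to \<open>L(x, v) - p \<bullet> v\<close> removes the constraint on the displacement
  (\<open>separating_momentum\<close>). For the tilted Lagrangian, the least cost of a path from \<open>y0\<close> to \<open>x\<close> in time
  \<open>t\<close> is a subsolution of the Hamilton-Jacobi equation whose increment at \<open>y0\<close> is the wanted bound. A
  smooth subsolution is an admissible test function and bounds the action from below
  (\<open>gQ_ge_subsolution\<close>); so the value function has to be smoothed without losing the inequality
  (\<open>smooth_subsolution\<close>). This is possible because it is locally Lipschitz for positive times
  (\<open>least_cost_lipschitz\<close>). The crucial estimate is \<open>least_cost_speed_up\<close>: since \<open>L\<close> does not depend on
  time, a path can be shortened in time by accelerating its slow parts, at a cost which convexity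
  controls although the growth of \<open>L\<close> in \<open>v\<close> is not restricted from above.

  Polygonal paths are general enough for both bounds, and they keep the measures elementary:
  each is a finite superposition of straight segments.\<close>

section \<open>Calculus of smooth functions\<close>

lemma Ck_SucI:
  assumes "\<And>x. (f has_derivative f' x) (at x)" and "\<And>v. Ck k (\<lambda>x. f' x v)"
  shows "Ck (Suc k) f"
proof -
  have "frechet_derivative f (at x) = f' x" for x
    using frechet_derivative_at[OF assms(1)] by simp
  then show ?thesis
    using assms by (auto simp: differentiable_def)
qed

lemma Ck_has_derivative:
  assumes "Ck (Suc k) f"
  shows "(f has_derivative frechet_derivative f (at x)) (at x)"
  using assms by (simp add: frechet_derivative_works)

lemma Ck_SucD: "Ck (Suc k) f \<Longrightarrow> Ck k f"
proof (induction k arbitrary: f)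
  case 0
  then show ?case
    by (simp add: continuous_at_imp_continuous_on differentiable_imp_continuous_within)
next
  case (Suc k)
  then show ?case
    by (metis Ck.simps(2))
qed

lemma Ck_continuous: "Ck k f \<Longrightarrow> continuous_on UNIV f"
  by (induction k) (use Ck_SucD Ck.simps(1) in blast)+

lemma Ck_const: "Ck k (\<lambda>x. c)"
  by (induction k arbitrary: c) (auto intro: Ck_SucI[where f' = "\<lambda>x v. 0"] simp del: Ck.simps(2))

lemma Ck_id: "Ck k (\<lambda>x. x)"
  by (cases k) (auto intro: Ck_SucI[where f' = "\<lambda>x v. v"] Ck_const simp del: Ck.simps(2))

lemma Ck_add:
  assumes "Ck k f" "Ck k g"
  shows "Ck k (\<lambda>x. f x + g x)"
  using assms
proof (induction k arbitrary: f g)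
  case 0
  then show ?case by (simp add: continuous_on_add)
next
  case (Suc k)
  show ?case
    using Suc.prems
    by (intro Ck_SucI[OF has_derivative_add[OF Ck_has_derivative Ck_has_derivative]] Suc.IH) auto
qed

lemma Ck_mult:
  fixes f g :: "'a::euclidean_space \<Rightarrow> real"
  assumes "Ck k f" "Ck k g"
  shows "Ck k (\<lambda>x. f x * g x)"
  using assms
proof (induction k arbitrary: f g)
  case 0
  then show ?case by (simp add: continuous_on_mult)
next
  case (Suc k)
  show ?case
    using Suc.prems Ck_SucD[OF Suc.prems(1)] Ck_SucD[OF Suc.prems(2)]
    by (intro Ck_SucI[OF has_derivative_mult[OF Ck_has_derivative Ck_has_derivative]] Suc.IH Ck_add) auto
qed

lemma Ck_prod:
  fixes f :: "'i \<Rightarrow> 'a::euclidean_space \<Rightarrow> real"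
  assumes "\<And>i. i \<in> I \<Longrightarrow> Ck k (f i)"
  shows "Ck k (\<lambda>x. \<Prod>i\<in>I. f i x)"
  using assms by (induction I rule: infinite_finite_induct) (auto intro: Ck_mult Ck_const)

lemma Ck_compose_affine:
  fixes g :: "real \<Rightarrow> real" and b :: "'a::euclidean_space"
  assumes "Ck k g"
  shows "Ck k (\<lambda>x. g (x \<bullet> b + c))"
  using assms
proof (induction k arbitrary: g)
  case 0
  then have "continuous_on UNIV g" by simp
  then show ?case
    by (auto intro!: continuous_intros intro: continuous_on_compose2[where g = g])
next
  case (Suc k)
  have g': "(g has_derivative frechet_derivative g (at r)) (at r)" for r
    using Ck_has_derivative[OF Suc.prems] .
  show ?case
  proof (rule Ck_SucI)
    show "((\<lambda>x. g (x \<bullet> b + c)) has_derivative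
        (\<lambda>v. frechet_derivative g (at (x \<bullet> b + c)) (v \<bullet> b))) (at x)" for x
      by (rule has_derivative_compose[OF _ g']) (auto intro!: derivative_eq_intros)
    show "Ck k (\<lambda>x. frechet_derivative g (at (x \<bullet> b + c)) (v \<bullet> b))" for v
      using Suc.prems by (intro Suc.IH) auto
  qed
qed

lemma smooth_has_derivative:
  "smooth f \<Longrightarrow> (f has_derivative frechet_derivative f (at x)) (at x)"
  unfolding smooth_def by (rule Ck_has_derivative) blast

lemma smooth_continuous: "smooth f \<Longrightarrow> continuous_on UNIV f"
  unfolding smooth_def by (rule Ck_continuous) blast

lemma smooth_derivative: "smooth f \<Longrightarrow> smooth (\<lambda>x. frechet_derivative f (at x) v)"
  unfolding smooth_def by (metis Ck.simps(2))

text \<open>Only small positive steps are needed, because the two-sided derivative is known to exist.\<close>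

lemma directional_derivative_le:
  fixes f :: "'a::real_normed_vector \<Rightarrow> real"
  assumes "(f has_derivative D) (at z)" and "0 < h0"
    and le: "\<And>h. 0 < h \<Longrightarrow> h < h0 \<Longrightarrow> f (z + h *\<^sub>R w) \<le> f z + h * q"
  shows "D w \<le> q"
proof -
  have "((\<lambda>h. f (z + h *\<^sub>R w)) has_derivative (\<lambda>h. D (h *\<^sub>R w))) (at (0::real))"
    by (rule has_derivative_compose[where g = f]) (use assms(1) in \<open>auto intro!: derivative_eq_intros\<close>)
  moreover have "(\<lambda>h. D (h *\<^sub>R w)) = (*) (D w)"
    using linear_scale[OF has_derivative_linear[OF assms(1)]] by (auto simp: mult.commute)
  ultimately have "((\<lambda>h. f (z + h *\<^sub>R w)) has_real_derivative D w) (at 0)"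
    by (simp add: has_field_derivative_def)
  then have "((\<lambda>h. (f (z + h *\<^sub>R w) - f z) / h) \<longlongrightarrow> D w) (at_right 0)"
    by (auto simp: has_field_derivative_iff intro: filterlim_at_split[THEN iffD1, THEN conjunct2])
  moreover have "\<forall>\<^sub>F h in at_right 0. (f (z + h *\<^sub>R w) - f z) / h \<le> q"
    using eventually_at_right_real[OF assms(2)]
    by eventually_elim (use le in \<open>force simp: divide_le_eq mult.commute\<close>)
  ultimately show ?thesis
    by (rule tendsto_upperbound) simp
qed

lemma periodic_derivative:
  fixes \<Phi> :: "'a::real_normed_vector \<Rightarrow> real"
  assumes "\<And>z. \<Phi> (z + w) = \<Phi> z" and "\<And>z. (\<Phi> has_derivative D z) (at z)"
  shows "D (z + w) = D z"
proof -
  have "((\<lambda>z. \<Phi> (z + w)) has_derivative D (z + w)) (at z)"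
    by (rule has_derivative_compose[where f = "\<lambda>z. z + w" and g = \<Phi>, OF _ assms(2)])
      (auto intro!: derivative_eq_intros)
  then show ?thesis
    using has_derivative_unique[OF _ assms(2)[of z]] by (simp add: assms(1))
qed

section \<open>A smooth bump function\<close>

text \<open>The factors \<open>x ^ n\<close> make the family closed under differentiation, which reduces smoothness of
  \<open>exp (- 1 / x)\<close>, continued by \<open>0\<close>, to one first-order computation.\<close>

definition flat_exp :: "nat \<Rightarrow> real \<Rightarrow> real" where
  "flat_exp n x = (if x > 0 then exp (- 1 / x) / x ^ n else 0)"

lemma flat_exp_limit: "((\<lambda>x. exp (- 1 / x) / x ^ n) \<longlongrightarrow> (0::real)) (at_right 0)"
  by real_asymp

lemma flat_exp_has_derivative:
  "(flat_exp n has_real_derivative (flat_exp (n + 2) x - n * flat_exp (n + 1) x)) (at x)"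
proof -
  consider "x > 0" | "x < 0" | "x = 0" by linarith
  then show ?thesis
  proof cases
    case 1
    have "((\<lambda>x. exp (- 1 / x) / x ^ n) has_real_derivative (flat_exp (n + 2) x - n * flat_exp (n + 1) x)) (at x)"
      using 1 by (auto intro!: derivative_eq_intros simp: flat_exp_def field_simps power_add power2_eq_square)
        (metis One_nat_def power_eq_if)
    then show ?thesis
      by (rule has_field_derivative_transform_within_open[where S = "{0<..}"])
        (use 1 in \<open>auto simp: flat_exp_def\<close>)
  next
    case 2
    have "((\<lambda>x. 0) has_real_derivative (flat_exp (n + 2) x - n * flat_exp (n + 1) x)) (at x)"
      using 2 by (auto simp: flat_exp_def)
    then show ?thesis
      by (rule has_field_derivative_transform_within_open[where S = "{..<0}"])
        (use 2 in \<open>auto simp: flat_exp_def\<close>)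
  next
    case 3
    have "((\<lambda>y. (flat_exp n y - flat_exp n 0) / (y - 0)) \<longlongrightarrow> 0) (at_right 0)"
    proof (rule Lim_transform_eventually[OF flat_exp_limit[of "Suc n"]])
      show "\<forall>\<^sub>F y in at_right 0. exp (- 1 / y) / y ^ Suc n = (flat_exp n y - flat_exp n 0) / (y - 0)"
        using eventually_at_right_less[of "0::real"] by eventually_elim (simp add: flat_exp_def)
    qed
    moreover have "((\<lambda>y. (flat_exp n y - flat_exp n 0) / (y - 0)) \<longlongrightarrow> 0) (at_left 0)"
    proof (rule Lim_transform_eventually[OF tendsto_const])
      show "\<forall>\<^sub>F y in at_left 0. 0 = (flat_exp n y - flat_exp n 0) / (y - 0)"
        by (simp add: eventually_at_filter flat_exp_def)
    qed
    ultimately have "(flat_exp n has_real_derivative 0) (at 0)"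
      unfolding has_field_derivative_iff by (subst filterlim_at_split) auto
    then show ?thesis
      using 3 by (simp add: flat_exp_def)
  qed
qed

lemma Ck_flat_exp: "Ck k (flat_exp n)"
proof (induction k arbitrary: n)
  case 0
  show ?case
    using flat_exp_has_derivative by (auto intro!: continuous_at_imp_continuous_on DERIV_isCont)
next
  case (Suc k)
  show ?case
  proof (rule Ck_SucI)
    show "(flat_exp n has_derivative (\<lambda>v. (flat_exp (n + 2) x + (- n) * flat_exp (n + 1) x) * v)) (at x)" for x
      using flat_exp_has_derivative[of n x] by (simp add: has_field_derivative_def)
    show "Ck k (\<lambda>x. (flat_exp (n + 2) x + (- n) * flat_exp (n + 1) x) * v)" for v
      by (intro Ck_mult Ck_add Ck_const Suc.IH)
  qed
qed

definition bump :: "real \<Rightarrow> 'a::euclidean_space \<Rightarrow> real" where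
  "bump e z = (\<Prod>b\<in>Basis. flat_exp 0 (z \<bullet> b + e) * flat_exp 0 (z \<bullet> (- b) + e))"

lemma smooth_bump: "smooth (bump e :: 'a::euclidean_space \<Rightarrow> real)"
  unfolding smooth_def bump_def by (intro allI Ck_prod Ck_mult Ck_compose_affine Ck_flat_exp)

lemma bump_nonneg: "bump e z \<ge> 0"
  unfolding bump_def by (auto intro!: prod_nonneg mult_nonneg_nonneg simp: flat_exp_def)

lemma bump_pos: "e > 0 \<Longrightarrow> bump e 0 > 0"
  unfolding bump_def by (auto intro!: prod_pos mult_pos_pos simp: flat_exp_def)

lemma bump_support:
  assumes "z \<notin> cbox (- (e *\<^sub>R One)) (e *\<^sub>R One)"
  shows "bump e z = 0"
proof -
  obtain b where b: "b \<in> Basis" "z \<bullet> b < - e \<or> z \<bullet> b > e"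
    using assms by (auto simp: mem_box inner_sum_left_Basis)
  then have "flat_exp 0 (z \<bullet> b + e) * flat_exp 0 (z \<bullet> (- b) + e) = 0"
    by (auto simp: flat_exp_def)
  with b(1) show ?thesis
    unfolding bump_def by (metis (mono_tags, lifting) finite_Basis prod_zero_iff)
qed

section \<open>Mollification\<close>

text \<open>Since the kernel is evaluated at \<open>w - z\<close>, this is the convolution of \<open>U\<close> with the reflected kernel;
  with this sign it becomes, after a translation, an average of the values \<open>U (y + z)\<close>.\<close>

definition conv :: "('a::euclidean_space \<Rightarrow> real) \<Rightarrow> ('a \<Rightarrow> real) \<Rightarrow> 'a \<Rightarrow> real" where
  "conv \<kappa> U z = (\<integral>w. \<kappa> (w - z) * U w \<partial>lborel)"

lemma integrable_compact_support:
  fixes f :: "'a::euclidean_space \<Rightarrow> real"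
  assumes "continuous_on UNIV f" and "\<And>x. x \<notin> cbox a b \<Longrightarrow> f x = 0"
  shows "integrable lborel f" and "integral\<^sup>L lborel f = integral (cbox a b) f"
proof -
  have eq: "(\<lambda>x. indicator (cbox a b) x *\<^sub>R f x) = f"
    using assms(2) by (intro ext) (auto simp: indicator_def)
  have "set_integrable lborel (cbox a b) f"
    unfolding set_integrable_def
    by (rule borel_integrable_compact) (use assms(1) continuous_on_subset in auto)
  then show "integrable lborel f" "integral\<^sup>L lborel f = integral (cbox a b) f"
    using set_borel_integral_eq_integral(2)[of "cbox a b" f]
    unfolding set_integrable_def set_lebesgue_integral_def eq by auto
qed

lemma conv_eq_integral_cbox:
  assumes "continuous_on UNIV \<kappa>" "continuous_on UNIV U"
    and "\<And>x. x \<notin> cbox (- (c *\<^sub>R One)) (c *\<^sub>R One) \<Longrightarrow> \<kappa> x = 0"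
    and "norm (z - z0) \<le> 1"
  shows "conv \<kappa> U z = integral (cbox (z0 - (c + 1) *\<^sub>R One) (z0 + (c + 1) *\<^sub>R One)) (\<lambda>w. \<kappa> (w - z) * U w)"
  unfolding conv_def
proof (rule integrable_compact_support)
  show "continuous_on UNIV (\<lambda>w. \<kappa> (w - z) * U w)"
    by (intro continuous_intros assms(2) continuous_on_compose2[OF assms(1)]) auto
  fix w assume w: "w \<notin> cbox (z0 - (c + 1) *\<^sub>R One) (z0 + (c + 1) *\<^sub>R One)"
  then obtain b where b: "b \<in> Basis" "w \<bullet> b < z0 \<bullet> b - (c + 1) \<or> w \<bullet> b > z0 \<bullet> b + (c + 1)"
    by (auto simp: mem_box inner_diff_left inner_add_left not_le)
  have "\<bar>(z - z0) \<bullet> b\<bar> \<le> 1"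
    using Basis_le_norm[OF b(1), of "z - z0"] assms(4) by linarith
  then have "(w - z) \<bullet> b < - c \<or> (w - z) \<bullet> b > c"
    using b(2) by (auto simp: inner_diff_left)
  then have "w - z \<notin> cbox (- (c *\<^sub>R One)) (c *\<^sub>R One)"
    using b(1) by (auto simp: mem_box not_le intro!: bexI[of _ b])
  then show "\<kappa> (w - z) * U w = 0"
    using assms(3) by simp
qed

text \<open>Differentiating under the integral sign makes all derivatives fall on the kernel, so the
  convolution is as smooth as the kernel although \<open>U\<close> is only continuous. The derivative of the kernel
  is again smooth with the same support, so the statement can be iterated.\<close>

lemma has_derivative_conv:
  fixes \<kappa> U :: "'a::euclidean_space \<Rightarrow> real"
  assumes \<kappa>: "smooth \<kappa>" and U: "continuous_on UNIV U"
    and supp: "\<And>x. x \<notin> cbox (- (c *\<^sub>R One)) (c *\<^sub>R One) \<Longrightarrow> \<kappa> x = 0"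
  shows kernel_derivative_support:
      "\<And>x v. x \<notin> cbox (- (c *\<^sub>R One)) (c *\<^sub>R One) \<Longrightarrow> frechet_derivative \<kappa> (at x) v = 0"
    and "(conv \<kappa> U has_derivative (\<lambda>v. conv (\<lambda>x. - frechet_derivative \<kappa> (at x) v) U z0)) (at z0)"
proof -
  define D where "D x = frechet_derivative \<kappa> (at x)" for x
  have D: "(\<kappa> has_derivative D x) (at x)" for x
    unfolding D_def by (rule smooth_has_derivative[OF \<kappa>])
  have D0: "D x v = 0" if x: "x \<notin> cbox (- (c *\<^sub>R One)) (c *\<^sub>R One)" for x v
  proof -
    have "(\<kappa> has_derivative (\<lambda>v. 0)) (at x)"
      by (rule has_derivative_transform_within_open[of "\<lambda>x. 0" _ _ _ "- cbox (- (c *\<^sub>R One)) (c *\<^sub>R One)"])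
        (use x supp in auto)
    then show ?thesis
      using has_derivative_unique[OF D] by metis
  qed
  then show "\<And>x v. x \<notin> cbox (- (c *\<^sub>R One)) (c *\<^sub>R One) \<Longrightarrow> frechet_derivative \<kappa> (at x) v = 0"
    unfolding D_def .
  have contD: "continuous_on UNIV (\<lambda>x. D x v)" for v
    unfolding D_def by (rule smooth_continuous[OF smooth_derivative[OF \<kappa>]])
  note cont\<kappa> = smooth_continuous[OF \<kappa>]
  define X where "X = cbox (z0 - (c + 1) *\<^sub>R One) (z0 + (c + 1) *\<^sub>R One)"
  have eq: "conv \<kappa> U z = integral X (\<lambda>w. \<kappa> (w - z) * U w)" if "z \<in> ball z0 1" for z
    unfolding X_def by (rule conv_eq_integral_cbox[OF cont\<kappa> U supp])
      (use that in \<open>auto simp: dist_norm norm_minus_commute\<close>)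
  \<comment> \<open>The rule for parameter integrals asks for the derivative as a bounded linear function that is
    continuous in operator norm; in finite dimension continuity on basis vectors is enough.\<close>
  define B where "B z w = Blinfun (\<lambda>v. - D (w - z) v * U w)" for z w
  have bl: "bounded_linear (\<lambda>v. - D x v * r)" for x r
    using D[of x] by (intro bounded_linear_mult_const bounded_linear_minus has_derivative_bounded_linear)
  have B: "blinfun_apply (B z w) = (\<lambda>v. - D (w - z) v * U w)" for z w
    unfolding B_def by (rule bounded_linear_Blinfun_apply[OF bl])
  have contB: "continuous_on S (\<lambda>p. B (fst p) (snd p))" for S
    by (rule continuous_on_blinfun_componentwise)
      (auto simp: B intro!: continuous_intros continuous_on_compose2[OF contD] continuous_on_compose2[OF U])
  have "((\<lambda>z. integral X (\<lambda>w. \<kappa> (w - z) * U w)) has_derivative integral X (B z0)) (at z0 within ball z0 1)"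
    unfolding X_def
  proof (rule leibniz_rule)
    show "((\<lambda>z. \<kappa> (w - z) * U w) has_derivative blinfun_apply (B z w)) (at z within ball z0 1)" for z w
      unfolding B
      by (rule has_derivative_at_withinI)
        (auto intro!: derivative_eq_intros has_derivative_compose[OF _ D]
           simp: linear_neg[OF has_derivative_linear[OF D]])
    show "(\<lambda>w. \<kappa> (w - z) * U w) integrable_on cbox (z0 - (c + 1) *\<^sub>R One) (z0 + (c + 1) *\<^sub>R One)" for z
      by (intro integrable_continuous continuous_intros continuous_on_compose2[OF cont\<kappa>]
          continuous_on_compose2[OF U]) auto
    show "continuous_on (ball z0 1 \<times> cbox (z0 - (c + 1) *\<^sub>R One) (z0 + (c + 1) *\<^sub>R One)) (\<lambda>(z, w). B z w)"
      using contB by (simp add: case_prod_beta)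
  qed auto
  moreover have "blinfun_apply (integral X (B z0)) = (\<lambda>v. conv (\<lambda>x. - D x v) U z0)"
  proof
    fix v
    have "continuous_on X (\<lambda>w. (z0, w))"
      by (rule continuous_on_Pair[OF continuous_on_const continuous_on_id])
    from continuous_on_compose2[OF contB[of UNIV] this] have "continuous_on X (B z0)"
      by simp
    then have "blinfun_apply (integral X (B z0)) v = integral X (\<lambda>w. - D (w - z0) v * U w)"
      by (subst blinfun_apply_integral) (auto simp: X_def B intro!: integrable_continuous)
    also have "\<dots> = conv (\<lambda>x. - D x v) U z0"
      unfolding X_def
      by (rule conv_eq_integral_cbox[symmetric]) (use contD D0 U in \<open>auto intro!: continuous_intros\<close>)
    finally show "blinfun_apply (integral X (B z0)) v = conv (\<lambda>x. - D x v) U z0" .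
  qed
  ultimately have "((\<lambda>z. integral X (\<lambda>w. \<kappa> (w - z) * U w)) has_derivative
      (\<lambda>v. conv (\<lambda>x. - D x v) U z0)) (at z0)"
    using at_within_open[of z0 "ball z0 1"] by simp
  then show "(conv \<kappa> U has_derivative (\<lambda>v. conv (\<lambda>x. - frechet_derivative \<kappa> (at x) v) U z0)) (at z0)"
    unfolding D_def
    by (rule has_derivative_transform_within_open[where s = "ball z0 1"]) (auto simp: eq)
qed

lemma smooth_conv:
  assumes "smooth \<kappa>" and U: "continuous_on UNIV U"
    and "\<And>x. x \<notin> cbox (- (c *\<^sub>R One)) (c *\<^sub>R One) \<Longrightarrow> \<kappa> x = 0"
  shows "smooth (conv \<kappa> U)"
proof -
  have "Ck k (conv \<kappa> U)" for k
    using assms(1,3)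
  proof (induction k arbitrary: \<kappa>)
    case 0
    have "isCont (conv \<kappa> U) z" for z
      using has_derivative_conv(2)[OF 0(1) U 0(2)] by (rule has_derivative_continuous) auto
    then show ?case
      by (simp add: continuous_at_imp_continuous_on)
  next
    case (Suc k)
    show ?case
    proof (rule Ck_SucI[OF has_derivative_conv(2)[OF Suc.prems(1) U Suc.prems(2)]])
      fix v
      have "smooth (\<lambda>x. - frechet_derivative \<kappa> (at x) v)"
        using smooth_derivative[OF Suc.prems(1), of v] Ck_mult[OF Ck_const[of _ "-1"]]
        unfolding smooth_def by force
      then show "Ck k (conv (\<lambda>x. - frechet_derivative \<kappa> (at x) v) U)"
        by (rule Suc.IH) (use has_derivative_conv(1)[OF Suc.prems(1) U Suc.prems(2)] in auto)
    qed auto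
  qed
  then show ?thesis
    by (simp add: smooth_def)
qed

lemma conv_shift:
  fixes U :: "'a::euclidean_space \<Rightarrow> real"
  assumes "continuous_on UNIV \<kappa>" "continuous_on UNIV U"
  shows "conv \<kappa> U z = (\<integral>y. \<kappa> y * U (y + z) \<partial>lborel)"
proof -
  have "(\<lambda>w. \<kappa> (w - z) * U w) \<in> borel_measurable borel"
    by (intro borel_measurable_continuous_onI continuous_intros continuous_on_compose2[OF assms(1)]
        continuous_on_compose2[OF assms(2)]) auto
  then have "(\<integral>w. \<kappa> (w - z) * U w \<partial>distr lborel borel ((+) z)) = (\<integral>y. \<kappa> y * U (y + z) \<partial>lborel)"
    by (subst integral_distr) (auto simp: algebra_simps)
  then show ?thesis
    by (simp add: conv_def lborel_distr_plus)
qed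

definition mollify :: "real \<Rightarrow> ('a::euclidean_space \<Rightarrow> real) \<Rightarrow> 'a \<Rightarrow> real" where
  "mollify e U z = conv (bump e) U z / integral\<^sup>L lborel (bump e :: 'a \<Rightarrow> real)"

lemma smooth_mollify: "continuous_on UNIV U \<Longrightarrow> smooth (mollify e U)"
  using smooth_conv[OF smooth_bump _ bump_support, of U e]
    Ck_mult[OF _ Ck_const[of _ "1 / integral\<^sup>L lborel (bump e :: 'a \<Rightarrow> real)"]]
  unfolding smooth_def mollify_def by force

lemma integrable_bump:
  fixes U :: "'a::euclidean_space \<Rightarrow> real"
  assumes "continuous_on UNIV U"
  shows "integrable lborel (\<lambda>y. bump e y * U y)"
  by (rule integrable_compact_support(1)[where a = "- (e *\<^sub>R One)" and b = "e *\<^sub>R One"])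
    (auto simp: bump_support intro!: continuous_intros assms smooth_continuous[OF smooth_bump])

lemma integral_bump_pos:
  assumes "e > 0"
  shows "integral\<^sup>L lborel (bump e :: 'a::euclidean_space \<Rightarrow> real) > 0"
proof -
  let ?X = "cbox (- (e *\<^sub>R One)) (e *\<^sub>R One) :: 'a set"
  note c = smooth_continuous[OF smooth_bump[of e]]
  have eq: "integral\<^sup>L lborel (bump e :: 'a \<Rightarrow> real) = integral ?X (bump e)"
    by (rule integrable_compact_support(2)[OF c bump_support])
  have "integral ?X (bump e) \<noteq> 0"
  proof (subst integral_cbox_eq_0_iff)
    show "continuous_on ?X (bump e)" using c continuous_on_subset by blast
    show "box (- (e *\<^sub>R One)) (e *\<^sub>R One :: 'a) \<noteq> {}"
      using assms by (auto simp: box_ne_empty)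
    have "0 \<in> ?X" using assms by (auto simp: mem_box)
    then show "\<not> (\<forall>x\<in>?X. bump e x = 0)" using bump_pos[OF assms] by (metis less_irrefl)
  qed (auto simp: bump_nonneg)
  moreover have "integral ?X (bump e) \<ge> 0"
    by (rule integral_nonneg) (auto intro!: integrable_continuous continuous_on_subset[OF c] bump_nonneg)
  ultimately show ?thesis using eq by simp
qed

text \<open>Every estimate on a mollified function used below is an instance: taking \<open>W = U\<close> compares values at
  two points, and taking one of the functions constant compares \<open>mollify e U\<close> with \<open>U\<close>.\<close>

lemma mollify_le:
  fixes U W :: "'a::euclidean_space \<Rightarrow> real"
  assumes "e > 0" "continuous_on UNIV U" "continuous_on UNIV W"
    and le: "\<And>y. y \<in> cbox (- (e *\<^sub>R One)) (e *\<^sub>R One) \<Longrightarrow> U (y + z) \<le> W (y + z') + c"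
  shows "mollify e U z \<le> mollify e W z' + c"
proof -
  let ?I = "integral\<^sup>L lborel (bump e :: 'a \<Rightarrow> real)"
  note I = integral_bump_pos[OF assms(1), where 'a = 'a]
  note cb = smooth_continuous[OF smooth_bump[of e]]
  have contU: "continuous_on UNIV (\<lambda>y. U (y + z))"
    by (rule continuous_on_compose2[OF assms(2)]) (auto intro!: continuous_intros)
  have contW: "continuous_on UNIV (\<lambda>y. W (y + z'))"
    by (rule continuous_on_compose2[OF assms(3)]) (auto intro!: continuous_intros)
  have "conv (bump e) U z = (\<integral>y. bump e y * U (y + z) \<partial>lborel)"
    by (rule conv_shift[OF cb assms(2)])
  also have "\<dots> \<le> (\<integral>y. bump e y * W (y + z') + bump e y * c \<partial>lborel)"
  proof (rule integral_mono)
    show "bump e y * U (y + z) \<le> bump e y * W (y + z') + bump e y * c" for y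
    proof (cases "y \<in> cbox (- (e *\<^sub>R One)) (e *\<^sub>R One)")
      case True
      then show ?thesis
        using mult_left_mono[OF le bump_nonneg, of y e y] by (simp add: distrib_left)
    qed (simp add: bump_support)
  qed (intro Bochner_Integration.integrable_add integrable_bump contU contW continuous_on_const)+
  also have "\<dots> = conv (bump e) W z' + ?I * c"
    unfolding conv_shift[OF cb assms(3)]
    using integrable_bump[OF contW] integrable_bump[OF continuous_on_const[of _ c]]
    by (subst Bochner_Integration.integral_add) auto
  finally show ?thesis
    unfolding mollify_def using I by (simp add: field_simps)
qed

lemma mollify_const:
  assumes "e > 0"
  shows "mollify e (\<lambda>z::'a::euclidean_space. c) z = c"
  using integral_bump_pos[OF assms, where 'a = 'a] unfolding mollify_def
  by (subst conv_shift[OF smooth_continuous[OF smooth_bump]]) auto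

section \<open>Polygonal paths\<close>

text \<open>A list entry \<open>(h, v)\<close> stands for moving with constant velocity \<open>v\<close> during time \<open>h\<close>.\<close>

type_synonym 'a polygon = "(real \<times> 'a) list"

primrec dur :: "'a polygon \<Rightarrow> real" where
  "dur [] = 0"
| "dur (p # l) = fst p + dur l"

primrec disp :: "'a::real_vector polygon \<Rightarrow> 'a" where
  "disp [] = 0"
| "disp (p # l) = fst p *\<^sub>R snd p + disp l"

primrec len :: "'a::real_normed_vector polygon \<Rightarrow> real" where
  "len [] = 0"
| "len (p # l) = fst p * norm (snd p) + len l"

primrec cost :: "('a::real_vector \<Rightarrow> 'a \<Rightarrow> real) \<Rightarrow> 'a \<Rightarrow> 'a polygon \<Rightarrow> real" where
  "cost \<l> y [] = 0"
| "cost \<l> y (p # l) =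
     integral {0..fst p} (\<lambda>s. \<l> (y + s *\<^sub>R snd p) (snd p)) + cost \<l> (y + fst p *\<^sub>R snd p) l"

definition forward :: "'a polygon \<Rightarrow> bool" where
  "forward l \<longleftrightarrow> (\<forall>p\<in>set l. 0 \<le> fst p)"

lemma forward_simps [simp]:
  "forward []" "forward (p # l) \<longleftrightarrow> 0 \<le> fst p \<and> forward l"
  "forward (l @ l') \<longleftrightarrow> forward l \<and> forward l'"
  by (auto simp: forward_def)

lemma dur_append [simp]: "dur (l @ l') = dur l + dur l'"
  by (induction l) auto

lemma dur_nonneg: "forward l \<Longrightarrow> 0 \<le> dur l"
  by (induction l) auto

lemma disp_append [simp]: "disp (l @ l') = disp l + disp l'"
  by (induction l) auto

lemma cost_append: "cost \<l> y (l @ l') = cost \<l> y l + cost \<l> (y + disp l) l'"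
  by (induction l arbitrary: y) (auto simp: add.assoc)

lemma torus_rel_refl [simp]: "torus_rel x x"
  by (simp add: torus_rel_def)

lemma torus_rel_sym: "torus_rel x y \<Longrightarrow> torus_rel y x"
  using equivp_torus_rel by (rule equivp_symp)

lemma torus_rel_trans: "torus_rel x y \<Longrightarrow> torus_rel y z \<Longrightarrow> torus_rel x z"
  using equivp_torus_rel by (rule equivp_transp)

lemma torus_rel_add: "torus_rel x y \<Longrightarrow> torus_rel (x + z) (y + z)"
  by (simp add: torus_rel_def)

lemma torus_rel_cube:
  fixes x y :: "real ^ 'n::finite"
  obtains z where "torus_rel z x" "z - y \<in> cbox 0 One"
proof
  let ?z = "\<chi> i. y $ i + frac (x $ i - y $ i)"
  show "torus_rel ?z x"
    by (simp add: torus_rel_def frac_def)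
  show "?z - y \<in> cbox 0 One"
    unfolding mem_box
  proof
    fix b :: "real ^ 'n" assume b: "b \<in> Basis"
    then obtain i where i: "b = axis i 1" by (auto simp: Basis_vec_def)
    then have "(?z - y) \<bullet> b = frac (x $ i - y $ i)" by (simp add: inner_axis)
    then show "0 \<bullet> b \<le> (?z - y) \<bullet> b \<and> (?z - y) \<bullet> b \<le> One \<bullet> b"
      using b frac_lt_1[of "x $ i - y $ i"] by (simp add: frac_ge_0 less_imp_le)
  qed
qed

section \<open>Periodic Lagrangians\<close>

text \<open>The properties of a Lagrangian that the argument uses, stated for its periodic lift to \<open>\<real>\<^sup>n\<close>.
  They are stable under subtracting \<open>p \<bullet> v\<close>, and the lower bound depends on that. Superlinearity is
  uniform in the position; for a Lagrangian on the torus this is a consequence of pointwise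
  coercivity, convexity and compactness.\<close>

locale periodic_lagrangian =
  fixes \<l> :: "real ^ 'n::finite \<Rightarrow> real ^ 'n \<Rightarrow> real"
  assumes continuous: "continuous_on UNIV (\<lambda>(y, v). \<l> y v)"
    and periodic: "torus_rel y y' \<Longrightarrow> \<l> y v = \<l> y' v"
    and convex: "convex_on UNIV (\<l> y)"
    and superlinear: "\<exists>B. \<forall>y v. A * norm v - B \<le> \<l> y v"
begin

lemma continuous_compose [continuous_intros]:
  "continuous_on S f \<Longrightarrow> continuous_on S g \<Longrightarrow> continuous_on S (\<lambda>s. \<l> (f s) (g s))"
  using continuous_on_compose2[OF continuous, of S "\<lambda>s. (f s, g s)"] by (auto intro: continuous_on_Pair)

lemma integrable_segment: "(\<lambda>s. \<l> (y + s *\<^sub>R w) v) integrable_on {a..b}"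
  by (intro integrable_continuous_real continuous_intros)

lemma bounded: "\<exists>B\<ge>0. \<forall>y v. norm v \<le> R \<longrightarrow> \<bar>\<l> y v\<bar> \<le> B"
proof -
  have "compact ((\<lambda>(y, v). \<l> y v) ` (cbox 0 One \<times> cball 0 R))"
    by (intro compact_continuous_image compact_Times continuous_on_subset[OF continuous]) auto
  from compact_imp_bounded[OF this] obtain B where
    B: "0 < B" "\<forall>z\<in>(\<lambda>(y, v). \<l> y v) ` (cbox 0 One \<times> cball 0 R). norm z \<le> B"
    unfolding bounded_pos by (elim exE conjE)
  show ?thesis
  proof (intro exI conjI allI impI)
    show "\<bar>\<l> y v\<bar> \<le> B" if v: "norm v \<le> R" for y v
    proof -
      obtain z where z: "torus_rel z y" "z - 0 \<in> cbox 0 One" by (rule torus_rel_cube)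
      then have "norm (\<l> z v) \<le> B" using v B(2) by force
      then show ?thesis using periodic[OF z(1)] by simp
    qed
  qed (use B in auto)
qed

text \<open>Uniformity is only available for bounded velocities: nothing restricts how fast the dependence on
  the position grows with \<open>v\<close>.\<close>

lemma uniformly_continuous_position:
  assumes "\<epsilon> > 0"
  obtains \<delta> where "0 < \<delta>" "\<And>y y' v. norm v \<le> R \<Longrightarrow> norm (y' - y) < \<delta> \<Longrightarrow> \<bar>\<l> y' v - \<l> y v\<bar> < \<epsilon>"
proof -
  let ?K = "cbox (- One) (2 *\<^sub>R One) :: (real ^ 'n) set"
  have "uniformly_continuous_on (?K \<times> cball 0 R) (\<lambda>(y, v). \<l> y v)"
    by (intro compact_uniformly_continuous compact_Times continuous_on_subset[OF continuous]) auto
  then obtain d where d: "d > 0" "\<And>p q. p \<in> ?K \<times> cball 0 R \<Longrightarrow> q \<in> ?K \<times> cball 0 R \<Longrightarrow>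
      dist q p < d \<Longrightarrow> dist ((\<lambda>(y, v). \<l> y v) q) ((\<lambda>(y, v). \<l> y v) p) < \<epsilon>"
    using assms unfolding uniformly_continuous_on_def by metis
  show thesis
  proof
    show "0 < min d 1" using d by simp
    fix y y' v :: "real ^ 'n" assume v: "norm v \<le> R" and y': "norm (y' - y) < min d 1"
    obtain z where z: "torus_rel z y" "z - 0 \<in> cbox 0 One" by (rule torus_rel_cube)
    \<comment> \<open>Moving both points by the same lattice vector puts \<open>y\<close> in the unit cube and \<open>y'\<close> close to it.\<close>
    let ?z = "z + (y' - y)"
    have "torus_rel ?z y'" using torus_rel_add[OF z(1), of "y' - y"] by simp
    have "z \<in> ?K" using z(2) by (force simp: mem_box)
    moreover have "?z \<in> ?K"
      unfolding mem_box
    proof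
      fix b :: "real ^ 'n" assume b: "b \<in> Basis"
      have "\<bar>(y' - y) \<bullet> b\<bar> \<le> 1" using Basis_le_norm[OF b, of "y' - y"] y' by linarith
      moreover have "0 \<le> z \<bullet> b \<and> z \<bullet> b \<le> 1" using z(2) b by (auto simp: mem_box)
      ultimately show "- One \<bullet> b \<le> ?z \<bullet> b \<and> ?z \<bullet> b \<le> (2 *\<^sub>R One) \<bullet> b"
        using b by (auto simp: inner_add_left inner_diff_left)
    qed
    ultimately have "dist (\<l> ?z v) (\<l> z v) < \<epsilon>"
      using d(2)[of "(z, v)" "(?z, v)"] v y' by (auto simp: dist_Pair_Pair dist_norm)
    then show "\<bar>\<l> y' v - \<l> y v\<bar> < \<epsilon>"
      using periodic[OF z(1)] periodic[OF \<open>torus_rel ?z y'\<close>] by (simp add: dist_real_def)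
  qed
qed

lemma cost_periodic: "torus_rel y y' \<Longrightarrow> cost \<l> y l = cost \<l> y' l"
proof (induction l arbitrary: y y')
  case (Cons p l)
  then show ?case
    using Cons.IH[OF torus_rel_add[OF Cons.prems]] periodic[OF torus_rel_add[OF Cons.prems]] by simp
qed simp

lemma continuous_cost: "continuous_on UNIV (\<lambda>y. cost \<l> y l)"
proof (induction l)
  case (Cons p l)
  have "continuous_on UNIV (\<lambda>y. integral (cbox 0 (fst p)) (\<lambda>s. \<l> (y + s *\<^sub>R snd p) (snd p)))"
    by (rule integral_continuous_on_param) (auto simp: case_prod_beta intro!: continuous_intros)
  moreover have "continuous_on UNIV (\<lambda>y. cost \<l> (y + fst p *\<^sub>R snd p) l)"
    by (rule continuous_on_compose2[OF Cons.IH]) (auto intro!: continuous_intros)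
  ultimately show ?case
    by (simp add: continuous_on_add)
qed auto

lemma cost_lower:
  assumes "\<And>y v. A * norm v - B \<le> \<l> y v" and "forward l"
  shows "A * len l - B * dur l \<le> cost \<l> y l"
  using assms(2)
proof (induction l arbitrary: y)
  case (Cons p l)
  have "fst p * (A * norm (snd p) - B) = integral {0..fst p} (\<lambda>s. A * norm (snd p) - B)"
    using Cons.prems by simp
  also have "\<dots> \<le> integral {0..fst p} (\<lambda>s. \<l> (y + s *\<^sub>R snd p) (snd p))"
    by (intro integral_le integrable_segment assms) auto
  finally show ?case
    using Cons.IH[of "y + fst p *\<^sub>R snd p"] Cons.prems by (simp add: algebra_simps)
qed simp

lemma cost_ge: "\<exists>B. \<forall>y l. forward l \<longrightarrow> - (B * dur l) \<le> cost \<l> y l"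
proof -
  obtain B where B: "\<And>y v. 0 * norm v - B \<le> \<l> y v" using superlinear[of 0] by blast
  show ?thesis
    using cost_lower[OF B] by (intro exI[of _ B]) auto
qed

section \<open>Speeding up polygonal paths\<close>

text \<open>The polygon runs through the same points, but its slow segments, those with speed at most \<open>R\<close>, take only the
  fraction \<open>r\<close> of their time. Restricting to slow segments is what keeps the additional cost under
  control, since \<open>\<l>\<close> may grow arbitrarily fast in the velocity.\<close>

definition speed_up :: "real \<Rightarrow> real \<Rightarrow> (real ^ 'n) polygon \<Rightarrow> (real ^ 'n) polygon" where
  "speed_up R r = map (\<lambda>p. if norm (snd p) \<le> R then (fst p * r, (1 / r) *\<^sub>R snd p) else p)"

definition slow :: "real \<Rightarrow> (real ^ 'n) polygon \<Rightarrow> real" where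
  "slow R l = dur (filter (\<lambda>p. norm (snd p) \<le> R) l)"

lemma slow_simps [simp]:
  "slow R [] = 0" "slow R (p # l) = (if norm (snd p) \<le> R then fst p else 0) + slow R l"
  by (simp_all add: slow_def)

lemma forward_speed_up: "0 < r \<Longrightarrow> forward l \<Longrightarrow> forward (speed_up R r l)"
  by (induction l) (auto simp: speed_up_def)

lemma disp_speed_up: "0 < r \<Longrightarrow> disp (speed_up R r l) = disp l"
  by (induction l) (auto simp: speed_up_def)

lemma dur_speed_up: "dur (speed_up R r l) = dur l - (1 - r) * slow R l"
  by (induction l) (auto simp: speed_up_def algebra_simps)

text \<open>Time spent at speed above \<open>R\<close> contributes more than \<open>R\<close> times itself to the length.\<close>

lemma slow_ge: "0 \<le> R \<Longrightarrow> forward l \<Longrightarrow> R * dur l \<le> R * slow R l + len l"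
proof (induction l)
  case (Cons p l)
  have "R * fst p \<le> fst p * norm (snd p)" if "\<not> norm (snd p) \<le> R"
    using that Cons.prems mult_left_mono[of R "norm (snd p)" "fst p"] by (simp add: mult.commute)
  moreover have "0 \<le> fst p * norm (snd p)" "R * dur l \<le> R * slow R l + len l"
    using Cons by simp_all
  ultimately have "R * fst p + R * dur l \<le>
      (if norm (snd p) \<le> R then R * fst p else 0) + R * slow R l + (fst p * norm (snd p) + len l)"
    by (smt (verit, best))
  then show ?case
    by (simp add: distrib_left if_distrib[of "(*) R"] cong: if_cong)
qed simp

text \<open>With \<open>c = 1 / r - 1\<close>, the accelerated velocity is the convex combination
  \<open>(1 - c) *\<^sub>R v + c *\<^sub>R (2 *\<^sub>R v)\<close>, so convexity bounds its cost by values of \<open>\<l>\<close> at speeds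
  at most \<open>2 * R\<close>. The additional cost is proportional to the time gained.\<close>

lemma cost_speed_up:
  assumes B: "\<And>y v. norm v \<le> 2 * R \<Longrightarrow> \<bar>\<l> y v\<bar> \<le> B" and r: "1 / 2 \<le> r" "r \<le> 1"
    and "0 \<le> R" "forward l"
  shows "cost \<l> y (speed_up R r l) \<le> cost \<l> y l + 3 * B * ((1 - r) * slow R l)"
  using \<open>forward l\<close>
proof (induction l arbitrary: y)
  case (Cons p l)
  obtain h v where p: "p = (h, v)" by fastforce
  have h: "h \<ge> 0" and l: "forward l" using Cons.prems p by auto
  show ?case
  proof (cases "norm v \<le> R")
    case True
    let ?v = "(1 / r) *\<^sub>R v"
    have pt: "r * \<l> z ?v \<le> \<l> z v + 3 * B * (1 - r)" for z
    proof -
      have "(1 + c) *\<^sub>R v = (1 - c) *\<^sub>R v + c *\<^sub>R (2 *\<^sub>R v)" for c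
        by (simp add: scaleR_2 algebra_simps)
      from this[of "1 / r - 1"]
      have "\<l> z ?v = \<l> z ((1 - (1 / r - 1)) *\<^sub>R v + (1 / r - 1) *\<^sub>R (2 *\<^sub>R v))"
        by simp
      also have "\<dots> \<le> (1 - (1 / r - 1)) * \<l> z v + (1 / r - 1) * \<l> z (2 *\<^sub>R v)"
        by (rule convex_onD[OF convex]) (use r in \<open>auto simp: field_simps\<close>)
      finally have "r * \<l> z ?v \<le> r * ((1 - (1 / r - 1)) * \<l> z v + (1 / r - 1) * \<l> z (2 *\<^sub>R v))"
        using r by simp
      also have "\<dots> = \<l> z v + (1 - r) * (\<l> z (2 *\<^sub>R v) - 2 * \<l> z v)"
        using r by (simp add: field_simps)
      also have "\<dots> \<le> \<l> z v + (1 - r) * (3 * B)"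
        using B[of "2 *\<^sub>R v" z] B[of v z] r True \<open>0 \<le> R\<close> by (intro add_mono mult_left_mono) auto
      finally show ?thesis by (simp add: mult.commute)
    qed
    have "integral {0..h * r} (\<lambda>s. \<l> (y + s *\<^sub>R ?v) ?v) = r * integral {0..h} (\<lambda>s. \<l> (y + s *\<^sub>R v) ?v)"
    proof -
      have "((\<lambda>s. \<l> (y + (r * s) *\<^sub>R ?v) ?v) has_integral (1 / \<bar>r\<bar>) *\<^sub>R integral {0..h * r} (\<lambda>s. \<l> (y + s *\<^sub>R ?v) ?v))
         ((\<lambda>x. (1 / r) *\<^sub>R x + - ((1 / r) *\<^sub>R 0)) ` cbox 0 (h * r))"
        using has_integral_affinity[of "\<lambda>s. \<l> (y + s *\<^sub>R ?v) ?v" _ 0 "h * r" r 0]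
          integrable_integral[OF integrable_segment[of y ?v ?v 0 "h * r"]] r by simp
      moreover have "(\<lambda>x. (1 / r) *\<^sub>R x + - ((1 / r) *\<^sub>R 0)) ` cbox 0 (h * r) = {0..h}"
        using r h by (auto simp: image_iff field_simps intro!: bexI[of _ "_ * r"])
      ultimately have "integral {0..h} (\<lambda>s. \<l> (y + s *\<^sub>R v) ?v) = (1 / r) * integral {0..h * r} (\<lambda>s. \<l> (y + s *\<^sub>R ?v) ?v)"
        using r by (simp add: integral_unique)
      then show ?thesis using r by simp
    qed
    also have "\<dots> = integral {0..h} (\<lambda>s. r * \<l> (y + s *\<^sub>R v) ?v)" by simp
    also have "\<dots> \<le> integral {0..h} (\<lambda>s. \<l> (y + s *\<^sub>R v) v + 3 * B * (1 - r))"
      by (intro integral_le integrable_continuous_real continuous_intros pt)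
    also have "\<dots> = integral {0..h} (\<lambda>s. \<l> (y + s *\<^sub>R v) v) + 3 * B * (1 - r) * h"
      using h by (subst Henstock_Kurzweil_Integration.integral_add) (auto intro: integrable_segment)
    finally show ?thesis
      using Cons.IH[OF l, of "y + h *\<^sub>R v"] r True p by (simp add: speed_up_def algebra_simps)
  next
    case False
    then show ?thesis
      using Cons.IH[OF l, of "y + h *\<^sub>R v"] p by (simp add: speed_up_def algebra_simps)
  qed
qed (simp add: speed_up_def)

end

section \<open>The minimal cost of reaching a point\<close>

context periodic_lagrangian
begin

definition paths :: "real ^ 'n \<Rightarrow> real \<Rightarrow> real ^ 'n \<Rightarrow> (real ^ 'n) polygon set" where
  "paths y0 t x = {l. forward l \<and> dur l = t \<and> torus_rel (y0 + disp l) x}"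

text \<open>The value function of the free-endpoint problem started at \<open>y0\<close>, with the end point prescribed
  modulo the lattice. It is only meaningful for positive times.\<close>

definition least_cost :: "real ^ 'n \<Rightarrow> real \<Rightarrow> real ^ 'n \<Rightarrow> real" where
  "least_cost y0 t x = (INF l\<in>paths y0 t x. cost \<l> y0 l)"

lemma paths_nonempty:
  assumes "0 < t"
  obtains v where "t * norm v \<le> norm (One :: real ^ 'n)" "[(t, v)] \<in> paths y0 t x"
proof -
  obtain z where z: "torus_rel z x" "z - y0 \<in> cbox 0 One" by (rule torus_rel_cube)
  have "norm (z - y0) \<le> norm (One :: real ^ 'n)"
    using z(2) by (intro norm_le_componentwise) (auto simp: mem_box)
  then show thesis
    using assms z(1) by (intro that[of "(1 / t) *\<^sub>R (z - y0)"]) (auto simp: paths_def)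
qed

lemma bdd_below_cost: "bdd_below (cost \<l> y0 ` paths y0 t x)"
proof -
  obtain B where "\<And>y l. forward l \<Longrightarrow> - (B * dur l) \<le> cost \<l> y l" using cost_ge by blast
  then show ?thesis by (intro bdd_belowI[of _ "- (B * t)"]) (auto simp: paths_def)
qed

lemma least_cost_le: "l \<in> paths y0 t x \<Longrightarrow> least_cost y0 t x \<le> cost \<l> y0 l"
  unfolding least_cost_def by (rule cINF_lower[OF bdd_below_cost])

lemma le_least_cost:
  "0 < t \<Longrightarrow> (\<And>l. l \<in> paths y0 t x \<Longrightarrow> c \<le> cost \<l> y0 l) \<Longrightarrow> c \<le> least_cost y0 t x"
  unfolding least_cost_def using paths_nonempty by (intro cINF_greatest) blast+

lemma least_cost_periodic: "torus_rel x x' \<Longrightarrow> least_cost y0 t x = least_cost y0 t x'"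
  unfolding least_cost_def paths_def using torus_rel_trans torus_rel_sym by metis

text \<open>This is the subsolution property of the value function in integrated form, and it is proved by
  appending one segment.\<close>

lemma least_cost_extend:
  assumes "0 < t" "0 \<le> h"
  shows "least_cost y0 (t + h) (x + h *\<^sub>R v) \<le> least_cost y0 t x + integral {0..h} (\<lambda>s. \<l> (x + s *\<^sub>R v) v)"
proof -
  have "least_cost y0 (t + h) (x + h *\<^sub>R v) - integral {0..h} (\<lambda>s. \<l> (x + s *\<^sub>R v) v) \<le> cost \<l> y0 l"
    if l: "l \<in> paths y0 t x" for l
  proof -
    have rel: "torus_rel (y0 + disp l) x" using l by (simp add: paths_def)
    have "l @ [(h, v)] \<in> paths y0 (t + h) (x + h *\<^sub>R v)"
      using l assms(2) torus_rel_add[OF rel, of "h *\<^sub>R v"] by (simp add: paths_def add.assoc)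
    from least_cost_le[OF this] show ?thesis
      using periodic[OF torus_rel_add[OF rel]] by (simp add: cost_append)
  qed
  then have "least_cost y0 (t + h) (x + h *\<^sub>R v) - integral {0..h} (\<lambda>s. \<l> (x + s *\<^sub>R v) v) \<le> least_cost y0 t x"
    by (rule le_least_cost[OF assms(1)])
  then show ?thesis by linarith
qed

lemma least_cost_extend_bounded:
  assumes "0 < t" "0 \<le> h" and "\<And>s. 0 \<le> s \<Longrightarrow> s \<le> h \<Longrightarrow> \<l> (x + s *\<^sub>R v) v \<le> B"
  shows "least_cost y0 (t + h) (x + h *\<^sub>R v) \<le> least_cost y0 t x + h * B"
proof -
  have "integral {0..h} (\<lambda>s. \<l> (x + s *\<^sub>R v) v) \<le> integral {0..h} (\<lambda>s. B)"
    by (rule integral_le) (use assms(3) in \<open>auto intro: integrable_segment\<close>)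
  then show ?thesis
    using least_cost_extend[OF assms(1,2), of y0 x v] assms(2) by simp
qed

lemma least_cost_upper:
  assumes "0 < a"
  obtains K where "\<And>t x. a \<le> t \<Longrightarrow> t \<le> b \<Longrightarrow> least_cost y0 t x \<le> K"
proof -
  obtain B where B: "0 \<le> B" "\<And>y v. norm v \<le> norm (One :: real ^ 'n) / a \<Longrightarrow> \<bar>\<l> y v\<bar> \<le> B"
    using bounded[of "norm (One :: real ^ 'n) / a"] by blast
  have "least_cost y0 t x \<le> b * B" if t: "a \<le> t" "t \<le> b" for t x
  proof -
    have "0 < t" using t assms by simp
    then obtain v where v: "t * norm v \<le> norm (One :: real ^ 'n)" "[(t, v)] \<in> paths y0 t x"
      by (rule paths_nonempty)
    have "a * norm v \<le> t * norm v" using t by (intro mult_right_mono) auto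
    then have "norm v \<le> norm (One :: real ^ 'n) / a"
      using v(1) assms by (simp add: field_simps)
    note Bv = B(2)[OF this]
    have "least_cost y0 t x \<le> integral {0..t} (\<lambda>s. \<l> (y0 + s *\<^sub>R v) v)"
      using least_cost_le[OF v(2)] by simp
    also have "\<dots> \<le> integral {0..t} (\<lambda>s. B)"
      using Bv by (intro integral_le integrable_segment) (auto simp: abs_le_iff)
    also have "\<dots> \<le> b * B" using t \<open>0 < t\<close> B(1) by (simp add: mult_right_mono)
    finally show ?thesis .
  qed
  then show thesis by (rule that)
qed

text \<open>Arriving earlier is possible at a price proportional to the time gained. A nearly optimal path has
  bounded cost, hence bounded length by superlinearity, hence it spends at least the time \<open>a / 2\<close> on
  slow segments for a suitable threshold \<open>R\<close>; these absorb the acceleration. The argument moves pieces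
  of the path in time, and this is possible because \<open>\<l>\<close> does not depend on time.\<close>

lemma least_cost_speed_up:
  assumes "0 < a"
  obtains C where "0 \<le> C"
    "\<And>t x h. a \<le> t \<Longrightarrow> t \<le> b \<Longrightarrow> 0 \<le> h \<Longrightarrow> h \<le> a / 4 \<Longrightarrow>
      least_cost y0 (t - h) x \<le> least_cost y0 t x + C * h"
proof -
  obtain K where K: "\<And>t x. a \<le> t \<Longrightarrow> t \<le> b \<Longrightarrow> least_cost y0 t x \<le> K"
    using least_cost_upper[OF assms] by blast
  obtain B1 where B1: "\<And>y v. 1 * norm v - B1 \<le> \<l> y v" using superlinear by blast
  \<comment> \<open>\<open>E\<close> bounds the length of a nearly optimal path; \<open>R\<close> is chosen so that at most the time \<open>a / 2\<close> is
    spent above speed \<open>R\<close>.\<close>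
  define E where "E = max 0 (K + 1 + \<bar>B1\<bar> * b)"
  define R where "R = 2 * E / a"
  have R: "0 \<le> R" "R * a = 2 * E" using assms by (auto simp: R_def E_def)
  obtain B where B: "0 \<le> B" "\<And>y v. norm v \<le> 2 * R \<Longrightarrow> \<bar>\<l> y v\<bar> \<le> B" using bounded[of "2 * R"] by blast
  have "least_cost y0 (t - h) x \<le> least_cost y0 t x + 3 * B * h"
    if t: "a \<le> t" "t \<le> b" and h: "0 \<le> h" "h \<le> a / 4" for t x h
  proof (rule field_le_epsilon)
    fix \<eta> :: real assume \<eta>: "\<eta> > 0"
    have "0 < t" using t assms by simp
    obtain l where l: "l \<in> paths y0 t x" "cost \<l> y0 l < least_cost y0 t x + min \<eta> 1"
    proof -
      have "\<not> (least_cost y0 t x + min \<eta> 1 \<le> least_cost y0 t x)" using \<eta> by simp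
      then show thesis
        using le_least_cost[OF \<open>0 < t\<close>, of y0 x "least_cost y0 t x + min \<eta> 1"] that by force
    qed
    have fw: "forward l" and dur: "dur l = t" and rel: "torus_rel (y0 + disp l) x"
      using l(1) by (auto simp: paths_def)
    have "1 * len l - B1 * dur l \<le> cost \<l> y0 l" by (rule cost_lower[OF B1 fw])
    moreover have "B1 * t \<le> \<bar>B1\<bar> * b" using t \<open>0 < t\<close> by (intro mult_mono) auto
    ultimately have "len l \<le> K + 1 + \<bar>B1\<bar> * b"
      using l(2) K[OF t, of x] dur by auto
    then have "len l \<le> E" by (simp add: E_def)
    then have slow: "R * t \<le> R * slow R l + R * (a / 2)"
      using slow_ge[OF R(1) fw] dur R(2) by simp
    \<comment> \<open>For \<open>R = 0\<close> the estimate above is empty, but then the path has length \<open>0\<close> and never leaves the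
      slow regime.\<close>
    have "slow R l \<ge> a / 2"
    proof (cases "R = 0")
      case True
      then have "E = 0" using R assms by simp
      with \<open>len l \<le> E\<close> have "len l \<le> 0" by simp
      have "dur l = slow 0 l"
        using fw \<open>len l \<le> 0\<close>
      proof (induction l)
        case (Cons p l)
        have "0 \<le> len l" using Cons.prems(1) by (induction l) auto
        moreover have "0 \<le> fst p * norm (snd p)" using Cons.prems(1) by simp
        ultimately have "fst p * norm (snd p) \<le> 0" "len l \<le> 0"
          using Cons.prems(2) unfolding len.simps by linarith+
        then show ?case
          using Cons by (auto simp: mult_le_0_iff)
      qed simp
      then show ?thesis using True dur t assms by simp
    next
      case False
      then have "t \<le> slow R l + a / 2"
        using slow R(1) by (metis distrib_left mult_le_cancel_left_pos order_le_less)
      then show ?thesis using t by simp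
    qed
    then have S: "slow R l > 0" "h / slow R l \<le> 1 / 2" using assms h by (auto simp: field_simps)
    define r where "r = 1 - h / slow R l"
    have r: "1 / 2 \<le> r" "r \<le> 1" "(1 - r) * slow R l = h"
      using S h by (auto simp: r_def)
    have "speed_up R r l \<in> paths y0 (t - h) x"
      using fw dur rel r by (simp add: paths_def forward_speed_up disp_speed_up dur_speed_up)
    from least_cost_le[OF this]
    have "least_cost y0 (t - h) x \<le> cost \<l> y0 l + 3 * B * h"
      using cost_speed_up[OF B(2) r(1,2) R(1) fw, of y0] r(3) by simp
    then show "least_cost y0 (t - h) x \<le> least_cost y0 t x + 3 * B * h + \<eta>"
      using l(2) by linarith
  qed
  then show thesis using B(1) by (intro that[of "3 * B"]) auto
qed

text \<open>In time: waiting makes a path longer at bounded cost, and speeding up makes it shorter. In space: leave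
  earlier by the distance and use the time gained to walk to the new end point at unit speed. The
  margin between \<open>a\<close> and \<open>2 * a\<close> leaves room for this last step.\<close>

lemma least_cost_lipschitz:
  assumes "0 < a"
  obtains C where "0 \<le> C"
    "\<And>t t' x x'. t \<in> {2 * a..b} \<Longrightarrow> t' \<in> {2 * a..b} \<Longrightarrow> \<bar>t' - t\<bar> \<le> a / 4 \<Longrightarrow> norm (x' - x) \<le> a / 4 \<Longrightarrow>
      least_cost y0 t' x' \<le> least_cost y0 t x + C * (\<bar>t' - t\<bar> + norm (x' - x))"
proof -
  obtain C where C: "0 \<le> C"
    "\<And>t x h. a \<le> t \<Longrightarrow> t \<le> b \<Longrightarrow> 0 \<le> h \<Longrightarrow> h \<le> a / 4 \<Longrightarrow>
      least_cost y0 (t - h) x \<le> least_cost y0 t x + C * h"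
    using least_cost_speed_up[OF assms] by blast
  obtain B where B: "0 \<le> B" "\<And>y v. norm v \<le> 1 \<Longrightarrow> \<bar>\<l> y v\<bar> \<le> B" using bounded[of "1"] by blast
  show thesis
  proof
    show "0 \<le> C + B" using C B by simp
    fix t t' :: real and x x' :: "real ^ 'n"
    assume t: "t \<in> {2 * a..b}" "t' \<in> {2 * a..b}" "\<bar>t' - t\<bar> \<le> a / 4" and x: "norm (x' - x) \<le> a / 4"
    have time: "least_cost y0 t' x \<le> least_cost y0 t x + (C + B) * \<bar>t' - t\<bar>"
    proof (cases "t' \<le> t")
      case True
      then have "least_cost y0 t' x \<le> least_cost y0 t x + C * \<bar>t' - t\<bar>"
        using C(2)[of t "t - t'" x] t assms by simp
      also have "\<dots> \<le> least_cost y0 t x + (C + B) * \<bar>t' - t\<bar>"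
        using B(1) by (intro add_left_mono mult_right_mono) auto
      finally show ?thesis .
    next
      case False
      then have "least_cost y0 t' x \<le> least_cost y0 t x + (t' - t) * B"
        using least_cost_extend_bounded[of t "t' - t" x 0 B y0] B(2)[of 0] t assms by (force simp: abs_le_iff)
      also have "\<dots> \<le> least_cost y0 t x + (C + B) * \<bar>t' - t\<bar>"
        using C(1) False by (simp add: distrib_right mult.commute)
      finally show ?thesis .
    qed
    let ?h = "norm (x' - x)"
    let ?v = "(1 / ?h) *\<^sub>R (x' - x)"
    have "least_cost y0 t' x' \<le> least_cost y0 t' x + (C + B) * ?h"
    proof (cases "x' = x")
      case False
      then have v: "norm ?v \<le> 1" "x + ?h *\<^sub>R ?v = x'" by auto
      have "least_cost y0 (t' - ?h + ?h) (x + ?h *\<^sub>R ?v) \<le> least_cost y0 (t' - ?h) x + ?h * B"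
        using B(2)[OF v(1)] t x assms by (intro least_cost_extend_bounded) (auto simp: abs_le_iff)
      also have "\<dots> \<le> least_cost y0 t' x + C * ?h + ?h * B"
        using C(2)[of t' ?h x] t x assms by simp
      finally show ?thesis unfolding v(2) by (simp add: algebra_simps)
    qed simp
    then show "least_cost y0 t' x' \<le> least_cost y0 t x + (C + B) * (\<bar>t' - t\<bar> + norm (x' - x))"
      using time by (simp add: distrib_left)
  qed
qed

section \<open>Smooth subsolutions\<close>

text \<open>The candidate is \<open>least_cost y0\<close>. It satisfies the inequality in integrated form, and at \<open>(T, y0)\<close> it
  is at least \<open>c\<close>, because the paths that return to \<open>y0\<close> at time \<open>T\<close> are the closed polygons. It is singular at time \<open>0\<close>, so time is
  shifted by a small \<open>s\<close>, and it is only locally Lipschitz, so it is mollified. Mollification shifts the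
  position argument of \<open>\<l>\<close>. For bounded velocities uniform continuity makes the resulting error small;
  for large ones the Lipschitz bound on the value function is weaker than superlinear growth, and the
  inequality holds with room to spare.\<close>

lemma smooth_subsolution:
  assumes T: "0 < T" and \<epsilon>: "0 < \<epsilon>"
    and c: "\<And>l. forward l \<Longrightarrow> dur l = T \<Longrightarrow> torus_rel (disp l) 0 \<Longrightarrow> c \<le> cost \<l> y0 l"
  obtains \<Phi> :: "real \<times> (real ^ 'n) \<Rightarrow> real" where "smooth \<Phi>"
    "\<And>t x x'. torus_rel x x' \<Longrightarrow> \<Phi> (t, x) = \<Phi> (t, x')"
    "\<And>t x v. 0 \<le> t \<Longrightarrow> t \<le> T \<Longrightarrow> frechet_derivative \<Phi> (at (t, x)) (1, v) \<le> \<l> x v + \<epsilon>"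
    "c - \<epsilon> \<le> \<Phi> (T, y0) - \<Phi> (0, y0)"
proof -
  \<comment> \<open>The constant for times near \<open>T\<close> must not depend on \<open>s\<close>, whereas the Lipschitz constant \<open>C\<close> below
    may blow up as \<open>s\<close> tends to \<open>0\<close>.\<close>
  obtain C\<^sub>T where CT: "0 \<le> C\<^sub>T"
    "\<And>t x h. T \<le> t \<Longrightarrow> t \<le> 2 * T \<Longrightarrow> 0 \<le> h \<Longrightarrow> h \<le> T / 4 \<Longrightarrow>
      least_cost y0 (t - h) x \<le> least_cost y0 t x + C\<^sub>T * h"
    using least_cost_speed_up[OF T] by blast
  obtain B0 where B0: "0 \<le> B0" "\<And>y v. norm v \<le> 0 \<Longrightarrow> \<bar>\<l> y v\<bar> \<le> B0" using bounded[of 0] by blast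
  define s where "s = min (T / 4) (\<epsilon> / (2 * (C\<^sub>T + B0 + 1)))"
  have s: "0 < s" "s \<le> T / 4" "s * (C\<^sub>T + B0) \<le> \<epsilon> / 2"
  proof -
    show "s \<le> T / 4" unfolding s_def by (rule min.cobounded1)
    show "0 < s" using T \<epsilon> CT(1) B0(1) by (auto simp: s_def)
    have "s * (C\<^sub>T + B0) \<le> s * (C\<^sub>T + B0 + 1)" using \<open>0 < s\<close> by simp
    also have "\<dots> \<le> \<epsilon> / (2 * (C\<^sub>T + B0 + 1)) * (C\<^sub>T + B0 + 1)"
      unfolding s_def using CT(1) B0(1) by (intro mult_right_mono) auto
    also have "\<dots> = \<epsilon> / 2" using CT(1) B0(1) by (simp add: field_simps)
    finally show "s * (C\<^sub>T + B0) \<le> \<epsilon> / 2" .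
  qed
  define b where "b = T + 2 * s"
  obtain C where C: "0 \<le> C"
    "\<And>t t' x x'. t \<in> {2 * (s / 4)..b} \<Longrightarrow> t' \<in> {2 * (s / 4)..b} \<Longrightarrow> \<bar>t' - t\<bar> \<le> (s / 4) / 4 \<Longrightarrow>
      norm (x' - x) \<le> (s / 4) / 4 \<Longrightarrow>
      least_cost y0 t' x' \<le> least_cost y0 t x + C * (\<bar>t' - t\<bar> + norm (x' - x))"
    using least_cost_lipschitz[of "s / 4"] s(1) by (metis zero_less_divide_iff zero_less_numeral)
  define K where "K = 2 * C"
  \<comment> \<open>Clamping makes the shifted value function globally defined and locally Lipschitz; on
    \<open>[0, T]\<close>, with a margin for mollification, only the shift by \<open>s\<close> remains.\<close>
  define clamp where "clamp t = max (s / 2) (min b (t + s))" for t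
  define U where "U z = least_cost y0 (clamp (fst z)) (snd z)" for z
  have clamp: "clamp t \<in> {2 * (s / 4)..b}" "\<bar>clamp t' - clamp t\<bar> \<le> \<bar>t' - t\<bar>" for t t'
    using s T by (auto simp: clamp_def b_def)
  have U_lip: "U z' \<le> U z + K * norm (z' - z)" if "norm (z' - z) \<le> s / 16" for z z'
  proof -
    have f: "\<bar>fst z' - fst z\<bar> \<le> norm (z' - z)" and g: "norm (snd z' - snd z) \<le> norm (z' - z)"
      using norm_fst_le[of "fst (z' - z)" "snd (z' - z)"] norm_snd_le[of "snd (z' - z)" "fst (z' - z)"]
      unfolding prod.collapse by simp_all
    have "U z' \<le> U z + C * (\<bar>clamp (fst z') - clamp (fst z)\<bar> + norm (snd z' - snd z))"
      unfolding U_def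
    proof (rule C(2)[OF clamp(1) clamp(1)])
      show "\<bar>clamp (fst z') - clamp (fst z)\<bar> \<le> s / 4 / 4"
        using clamp(2)[of "fst z'" "fst z"] f that by linarith
      show "norm (snd z' - snd z) \<le> s / 4 / 4"
        using g that by linarith
    qed
    also have "\<dots> \<le> U z + C * (norm (z' - z) + norm (z' - z))"
      using C(1) clamp(2)[of "fst z'" "fst z"] f g by (intro add_left_mono mult_left_mono add_mono) auto
    finally show ?thesis by (simp add: K_def)
  qed
  have K: "0 \<le> K" using C by (simp add: K_def)
  have contU: "continuous_on UNIV U"
    unfolding continuous_on_iff
  proof (intro ballI allI impI)
    fix z and \<eta> :: real assume "\<eta> > 0"
    let ?d = "min (s / 16) (\<eta> / (K + 1))"
    have "dist (U z') (U z) < \<eta>" if "dist z' z < ?d" for z'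
    proof -
      have "U z' \<le> U z + K * norm (z' - z)" "U z \<le> U z' + K * norm (z' - z)"
        using that U_lip[of z' z] U_lip[of z z'] by (auto simp: dist_norm norm_minus_commute)
      then have "dist (U z') (U z) \<le> K * norm (z' - z)" by (simp add: dist_real_def)
      also have "\<dots> \<le> (K + 1) * norm (z' - z)" by (simp add: mult_right_mono)
      also have "\<dots> < \<eta>" using that K by (simp add: dist_norm field_simps)
      finally show ?thesis .
    qed
    moreover have "?d > 0" using s(1) K \<open>\<eta> > 0\<close> by simp
    ultimately show "\<exists>d>0. \<forall>z'\<in>UNIV. dist z' z < d \<longrightarrow> dist (U z') (U z) < \<eta>" by blast
  qed
  obtain B where B: "\<And>y v. (2 * K + 1) * norm v - B \<le> \<l> y v" using superlinear by blast
  define R where "R = max 1 B"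
  have fast: "K * (1 + norm v) \<le> \<l> x v" if "R \<le> norm v" for x v
  proof -
    have "K * (1 + norm v) \<le> K * (norm v + norm v)"
      using that K by (intro mult_left_mono) (auto simp: R_def)
    then show ?thesis using B[of v x] that by (simp add: R_def algebra_simps)
  qed
  obtain \<delta> where \<delta>: "0 < \<delta>"
    "\<And>y y' v. norm v \<le> R \<Longrightarrow> norm (y' - y) < \<delta> \<Longrightarrow> \<bar>\<l> y' v - \<l> y v\<bar> < \<epsilon>"
    using uniformly_continuous_position[OF \<epsilon>] by blast
  define d where "d = min (s / 16) (min (\<delta> / 2) (\<epsilon> / (4 * (K + 1))))"
  have d: "0 < d" "d \<le> s / 16" "d \<le> \<delta> / 2" "K * d \<le> \<epsilon> / 4"
  proof -
    show "d \<le> s / 16" "d \<le> \<delta> / 2"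
      unfolding d_def by (rule min.cobounded1, rule min.coboundedI2[OF min.cobounded1])
    show "0 < d" using s(1) \<delta>(1) \<epsilon> K by (auto simp: d_def)
    have "K * d \<le> (K + 1) * (\<epsilon> / (4 * (K + 1)))"
      using K \<open>0 < d\<close> by (intro mult_mono) (auto simp: d_def)
    also have "\<dots> = \<epsilon> / 4" using K by (simp add: field_simps)
    finally show "K * d \<le> \<epsilon> / 4" .
  qed
  \<comment> \<open>The cube of half side \<open>e\<close>, the support of the kernel, lies in the ball of radius \<open>d\<close>.\<close>
  define e where "e = d / DIM(real \<times> (real ^ 'n))"
  have e: "0 < e" using d(1) by (simp add: e_def)
  have box: "norm y \<le> d" if "y \<in> cbox (- (e *\<^sub>R One)) (e *\<^sub>R One)" for y :: "real \<times> (real ^ 'n)"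
  proof -
    have "norm y \<le> (\<Sum>b\<in>Basis. \<bar>y \<bullet> b\<bar>)" by (rule norm_le_l1)
    also have "\<dots> \<le> of_nat DIM(real \<times> (real ^ 'n)) * e"
      using that by (intro sum_bounded_above) (auto simp: mem_box abs_le_iff minus_le_iff)
    finally show ?thesis by (simp add: e_def)
  qed
  define \<Phi> where "\<Phi> = mollify e U"
  have smooth: "smooth \<Phi>" unfolding \<Phi>_def by (rule smooth_mollify[OF contU])
  have near: "\<Phi> z \<le> U z + K * d" "U z \<le> \<Phi> z + K * d" for z
  proof -
    have U: "U (y + z) \<le> U z + K * d" "U z \<le> U (y + z) + K * d"
      if "y \<in> cbox (- (e *\<^sub>R One)) (e *\<^sub>R One)" for y
    proof -
      have "K * norm y \<le> K * d" using box[OF that] K by (rule mult_left_mono)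
      then show "U (y + z) \<le> U z + K * d" "U z \<le> U (y + z) + K * d"
        using U_lip[of "y + z" z] U_lip[of z "y + z"] box[OF that] d(2) by auto
    qed
    have "mollify e U z \<le> mollify e (\<lambda>_. U z) z + K * d"
      by (rule mollify_le[OF e contU continuous_on_const]) (rule U)
    then show "\<Phi> z \<le> U z + K * d" by (simp add: \<Phi>_def mollify_const[OF e])
    have "mollify e (\<lambda>_. U z) z \<le> mollify e U z + K * d"
      by (rule mollify_le[OF e continuous_on_const contU]) (rule U)
    then show "U z \<le> \<Phi> z + K * d" by (simp add: \<Phi>_def mollify_const[OF e])
  qed
  have periodic': "\<Phi> (t, x) = \<Phi> (t, x')" if "torus_rel x x'" for t x x'
  proof -
    have eq: "U (y + (t, x)) = U (y + (t, x'))" for y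
      unfolding U_def using least_cost_periodic[OF torus_rel_add[OF that, of "snd y"]]
      by (simp add: add.commute)
    show ?thesis
      unfolding \<Phi>_def
      using mollify_le[OF e contU contU, of "(t, x)" "(t, x')" 0]
        mollify_le[OF e contU contU, of "(t, x')" "(t, x)" 0] eq by (simp add: antisym)
  qed
  have subsolution: "frechet_derivative \<Phi> (at (t, x)) (1, v) \<le> \<l> x v + \<epsilon>"
    if t: "0 \<le> t" "t \<le> T" for t x v
  proof (rule directional_derivative_le[OF smooth_has_derivative[OF smooth]])
    let ?h0 = "min (s / (16 * (1 + norm v))) (\<delta> / (2 * (R + 1)))"
    have R: "0 < R" by (simp add: R_def)
    have pos: "1 + norm v > 0" using norm_ge_zero[of v] by linarith
    show "0 < ?h0" using s(1) \<delta>(1) R pos by simp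
    fix h assume h: "0 < h" "h < ?h0"
    have hv: "h * (1 + norm v) \<le> s / 16"
      using h pos by (simp add: field_simps)
    have hR: "h * R < \<delta> / 2"
    proof -
      have "h * R \<le> h * (R + 1)" using h by simp
      also have "\<dots> < \<delta> / 2" using h R by (simp add: field_simps)
      finally show ?thesis .
    qed
    have "h * 1 \<le> h * (1 + norm v)" using h by (intro mult_left_mono) auto
    then have hs: "h \<le> s / 16" using hv by linarith
    show "\<Phi> ((t, x) + h *\<^sub>R (1, v)) \<le> \<Phi> (t, x) + h * (\<l> x v + \<epsilon>)"
      unfolding \<Phi>_def
    proof (rule mollify_le[OF e contU contU])
      fix y :: "real \<times> (real ^ 'n)" assume "y \<in> cbox (- (e *\<^sub>R One)) (e *\<^sub>R One)"
      note y = box[OF this]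
      show "U (y + ((t, x) + h *\<^sub>R (1, v))) \<le> U (y + (t, x)) + h * (\<l> x v + \<epsilon>)"
      proof (cases "norm v \<le> R")
        case True
        have y12: "\<bar>fst y\<bar> \<le> d" "norm (snd y) \<le> d"
          using y norm_fst_le[of "fst y" "snd y"] norm_snd_le[of "snd y" "fst y"] by simp_all
        let ?t = "fst y + t + s" and ?x = "snd y + x"
        have cl: "clamp (fst y + t) = ?t" "clamp (fst y + (t + h)) = ?t + h"
          using y12 d(2) s(1) t hs h(1) by (auto simp: clamp_def b_def max_def min_def)
        have "least_cost y0 (?t + h) (?x + h *\<^sub>R v) \<le> least_cost y0 ?t ?x + h * (\<l> x v + \<epsilon>)"
        proof (rule least_cost_extend_bounded)
          show "0 < ?t" using y12 d(2) s(1) t by linarith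
          show "0 \<le> h" using h by simp
          fix r assume r: "0 \<le> r" "r \<le> h"
          have "norm ((?x + r *\<^sub>R v) - x) \<le> norm (snd y) + norm (r *\<^sub>R v)"
            using norm_triangle_ineq[of "snd y" "r *\<^sub>R v"] by (simp add: algebra_simps)
          also have "norm (r *\<^sub>R v) \<le> h * R" using r True by (simp add: mult_mono)
          finally have "norm ((?x + r *\<^sub>R v) - x) < \<delta>" using y12(2) d(3) hR by linarith
          from \<delta>(2)[OF True this] show "\<l> (?x + r *\<^sub>R v) v \<le> \<l> x v + \<epsilon>" by linarith
        qed
        then show ?thesis
          by (simp add: U_def cl) (simp add: algebra_simps cl)
      next
        case False
        have "norm (h *\<^sub>R (1::real, v)) = h * norm (1::real, v)"
          using h by (simp del: scaleR_Pair)
        also have "\<dots> \<le> h * (1 + norm v)"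
          using h norm_Pair_le[of "1::real" v] by (intro mult_left_mono) auto
        finally have step: "norm (h *\<^sub>R (1::real, v)) \<le> h * (1 + norm v)" .
        then have "K * norm (h *\<^sub>R (1::real, v)) \<le> K * (h * (1 + norm v))"
          using K by (rule mult_left_mono)
        also have "\<dots> = h * (K * (1 + norm v))" by simp
        also have "\<dots> \<le> h * (\<l> x v + \<epsilon>)"
          using fast[of v x] False h \<epsilon> by (intro mult_left_mono) auto
        finally show ?thesis
          using U_lip[of "y + ((t, x) + h *\<^sub>R (1, v))" "y + (t, x)"] hv step by (simp del: scaleR_Pair)
      qed
    qed
  qed
  have "c - \<epsilon> \<le> \<Phi> (T, y0) - \<Phi> (0, y0)"
  proof -
    have UT: "U (T, y0) = least_cost y0 (T + s) y0" and U0: "U (0, y0) = least_cost y0 s y0"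
      using s T by (auto simp: U_def clamp_def b_def max_def min_def)
    have "c \<le> least_cost y0 T y0"
    proof (rule le_least_cost[OF T])
      fix l assume "l \<in> paths y0 T y0"
      then show "c \<le> cost \<l> y0 l"
        by (intro c) (auto simp: paths_def torus_rel_def)
    qed
    also have "\<dots> \<le> least_cost y0 (T + s) y0 + C\<^sub>T * s"
      using CT(2)[of "T + s" s y0] s T by simp
    finally have 1: "c \<le> U (T, y0) + C\<^sub>T * s" by (simp add: UT)
    have "least_cost y0 s y0 \<le> cost \<l> y0 [(s, 0)]"
      using s(1) by (intro least_cost_le) (simp add: paths_def)
    also have "\<dots> \<le> s * B0" using s(1) B0(2)[of 0 y0] by (simp add: mult_left_mono)
    finally have 2: "U (0, y0) \<le> s * B0" by (simp add: U0)
    show ?thesis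
      using 1 2 near(2)[of "(T, y0)"] near(1)[of "(0, y0)"] d(4) s(3) by (simp add: algebra_simps)
  qed
  with smooth periodic' subsolution show thesis by (rule that)
qed

end

section \<open>Functions on the torus and their lifts\<close>

lemma abs_torus_eq_iff: "abs_torus x = abs_torus y \<longleftrightarrow> torus_rel x y"
  by (rule torus.abs_eq_iff)

lemma abs_rep_torus [simp]: "abs_torus (rep_torus x) = x"
  by (rule Quotient3_abs_rep[OF Quotient3_torus])

lemma rep_abs_torus: "torus_rel (rep_torus (abs_torus y)) y"
  by (simp flip: abs_torus_eq_iff)

lemma continuous_abs_torus: "continuous_on UNIV abs_torus"
  by (simp add: continuous_on_open_vimage open_torus_def)

lemma continuous_torusI:
  assumes "continuous_on UNIV (\<lambda>y. f (abs_torus y))"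
  shows "continuous_on UNIV f"
  using assms by (simp add: continuous_on_open_vimage open_torus_def vimage_def)

text \<open>A Borel section of the quotient map. The representatives chosen by \<open>rep_torus\<close> are arbitrary and need
  not depend measurably on the point.\<close>

definition frac_rep :: "'n::finite torus \<Rightarrow> real ^ 'n" where
  "frac_rep x = (\<chi> i. frac (rep_torus x $ i))"

lemma abs_frac_rep [simp]: "abs_torus (frac_rep x) = x"
proof -
  have "torus_rel (frac_rep x) (rep_torus x)"
    by (simp add: torus_rel_def frac_rep_def frac_def)
  then show ?thesis by (simp flip: abs_torus_eq_iff)
qed

lemma frac_rep_cbox: "frac_rep x \<in> cbox 0 One"
  unfolding mem_box
proof
  fix b :: "real ^ 'a" assume b: "b \<in> Basis"
  then obtain i where i: "b = axis i 1" by (auto simp: Basis_vec_def)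
  then have "frac_rep x \<bullet> b = frac (rep_torus x $ i)" by (simp add: frac_rep_def inner_axis)
  then show "0 \<bullet> b \<le> frac_rep x \<bullet> b \<and> frac_rep x \<bullet> b \<le> One \<bullet> b"
    using b frac_lt_1[of "rep_torus x $ i"] by (simp add: frac_ge_0 less_imp_le)
qed

lemma frac_rep_abs: "frac_rep (abs_torus y) $ i = frac (y $ i)"
proof -
  have "rep_torus (abs_torus y) $ i - y $ i \<in> \<int>"
    using rep_abs_torus[of y] by (simp add: torus_rel_def)
  then obtain k :: int where "rep_torus (abs_torus y) $ i = y $ i + of_int k"
    by (auto elim!: Ints_cases simp: algebra_simps)
  then show ?thesis by (simp add: frac_rep_def frac_def)
qed

text \<open>A coordinate takes values in \<open>{0<..<a}\<close> on an open set, since \<open>frac\<close> is continuous off the integers;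
  the points where it vanishes are the complement of such a set.\<close>

lemma borel_measurable_frac_rep: "frac_rep \<in> borel_measurable borel"
proof -
  have op: "open {x :: 'a torus. 0 < frac_rep x $ i \<and> frac_rep x $ i < a}" for i and a :: real
  proof -
    have "{y :: real ^ 'a. 0 < frac (y $ i) \<and> frac (y $ i) < a} =
        (\<Union>k::int. {y. of_int k < y $ i} \<inter> {y. y $ i < of_int k + min a 1})" (is "?L = ?R")
    proof (intro equalityI subsetI)
      fix y assume "y \<in> ?L"
      then show "y \<in> ?R"
        using frac_lt_1[of "y $ i"] by (auto simp: frac_def intro!: exI[of _ "\<lfloor>y $ i\<rfloor>"])
    next
      fix y assume "y \<in> ?R"
      then obtain k :: int where k: "of_int k < y $ i" "y $ i < of_int k + min a 1" by auto
      then have "\<lfloor>y $ i\<rfloor> = k" by (intro floor_unique) auto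
      then show "y \<in> ?L" using k by (auto simp: frac_def)
    qed
    moreover have "open ?R"
      by (intro open_UN open_Int ballI open_Collect_less continuous_intros)
    ultimately show ?thesis
      unfolding open_torus_def by (simp add: vimage_def frac_rep_abs)
  qed
  have "(\<lambda>x :: 'a torus. frac_rep x $ i) \<in> borel_measurable borel" for i
  proof (rule borel_measurableI_less)
    fix a :: real
    have nn: "0 \<le> frac_rep x $ i" "frac_rep x $ i < 1" for x :: "'a torus"
      by (simp_all add: frac_rep_def frac_ge_0 frac_lt_1)
    show "{x \<in> space borel. frac_rep x $ i < a} \<in> sets (borel :: 'a torus measure)"
    proof (cases "a > 0")
      case True
      have "{x :: 'a torus. frac_rep x $ i < a} =
        {x. 0 < frac_rep x $ i \<and> frac_rep x $ i < a} \<union> - {x. 0 < frac_rep x $ i \<and> frac_rep x $ i < 1}"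
        using True nn by (auto simp: le_less)
      then show ?thesis
        using op by (auto intro!: sets.Un borel_open)
    next
      case False
      then have "{x :: 'a torus. frac_rep x $ i < a} = {}"
        using nn(1) by (force simp: not_less intro: order_trans)
      then show ?thesis by simp
    qed
  qed
  then show ?thesis
    by (subst borel_measurable_euclidean_space) (auto simp: Basis_vec_def inner_axis)
qed

text \<open>Going through the section \<open>frac_rep\<close> reduces measurability on a product with the torus to
  measurability on a Euclidean space.\<close>

lemma lift_borel_measurable:
  fixes F :: "real \<times> (real ^ 'n::finite) \<times> (real ^ 'n) \<Rightarrow> 'b::euclidean_space"
  assumes F: "continuous_on UNIV F" and f: "\<And>t y v. f (t, abs_torus y, v) = F (t, y, v)"
  shows "f \<in> borel_measurable borel"
proof -
  have "(\<lambda>p :: real \<times> 'n torus \<times> (real ^ 'n). (fst p, frac_rep (fst (snd p)), snd (snd p))) \<in> borel_measurable borel"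
    by (intro borel_measurable_Pair measurable_compose[OF _ borel_measurable_frac_rep]
        borel_measurable_continuous_onI continuous_intros)
  from measurable_compose[OF this borel_measurable_continuous_onI[OF F]]
  have "(\<lambda>p. F (fst p, frac_rep (fst (snd p)), snd (snd p))) \<in> borel_measurable borel" .
  moreover have "F (fst p, frac_rep (fst (snd p)), snd (snd p)) = f p" for p
    using f[of "fst p" "frac_rep (fst (snd p))" "snd (snd p)"] by simp
  ultimately show ?thesis by simp
qed

lemma test_integrand_eq:
  fixes \<phi> :: "real \<Rightarrow> 'n::finite torus \<Rightarrow> real"
  defines "\<Phi> \<equiv> (\<lambda>(t, y). \<phi> t (abs_torus y))"
  assumes "smooth \<Phi>"
  shows "deriv (\<lambda>s. \<phi> s x) t + v \<bullet> torus_grad (\<phi> t) x =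
    frechet_derivative \<Phi> (at (t, rep_torus x)) (1, v)"
proof -
  let ?D = "frechet_derivative \<Phi> (at (t, rep_torus x))"
  have D: "(\<Phi> has_derivative ?D) (at (t, rep_torus x))"
    by (rule smooth_has_derivative[OF assms(2)])
  note lin = has_derivative_linear[OF D]
  have "((\<lambda>s. \<Phi> (s, rep_torus x)) has_derivative (\<lambda>s. ?D (s, 0))) (at t)"
    by (rule has_derivative_compose[where f = "\<lambda>s. (s, rep_torus x)" and g = \<Phi>, OF _ D]) (auto intro!: derivative_eq_intros)
  moreover have "(\<lambda>s. ?D (s, 0)) = (*) (?D (1, 0))"
  proof
    fix s show "?D (s, 0) = ?D (1, 0) * s"
      using linear_scale[OF lin, of s "(1, 0)"] by simp
  qed
  ultimately have "((\<lambda>s. \<phi> s x) has_field_derivative ?D (1, 0)) (at t)"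
    by (simp add: has_field_derivative_def \<Phi>_def)
  then have t: "deriv (\<lambda>s. \<phi> s x) t = ?D (1, 0)" by (rule DERIV_imp_deriv)
  have "((\<lambda>y. \<Phi> (t, y)) has_derivative (\<lambda>w. ?D (0, w))) (at (rep_torus x))"
    by (rule has_derivative_compose[where f = "\<lambda>y. (t, y)" and g = \<Phi>, OF _ D]) (auto intro!: derivative_eq_intros)
  then have "frechet_derivative (\<lambda>y. \<phi> t (abs_torus y)) (at (rep_torus x)) = (\<lambda>w. ?D (0, w))"
    unfolding \<Phi>_def by (simp flip: frechet_derivative_at)
  then have "v \<bullet> torus_grad (\<phi> t) x = (\<Sum>i\<in>UNIV. v $ i * ?D (0, axis i 1))"
    by (simp add: inner_vec_def torus_grad_def)
  also have "\<dots> = ?D (\<Sum>i\<in>UNIV. v $ i *\<^sub>R (0, axis i 1))"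
    by (simp add: linear_sum[OF lin] linear_scale[OF lin] del: scaleR_Pair)
  also have "(\<Sum>i\<in>UNIV. v $ i *\<^sub>R (0 :: real, axis i 1 :: real ^ 'n)) = (0, v)"
    using basis_expansion[of v] by (simp add: sum_prod scalar_mult_eq_scaleR)
  finally show ?thesis
    using t linear_add[OF lin, of "(1, 0)" "(0, v)"] by simp
qed

text \<open>By linearity the velocity enters through finitely many partial derivatives of \<open>\<Phi>\<close>, each of them
  continuous in the base point.\<close>

lemma continuous_derivative_pairing:
  fixes \<Phi> :: "real \<times> (real ^ 'n::finite) \<Rightarrow> real"
  assumes "smooth \<Phi>"
  shows "continuous_on UNIV (\<lambda>(t, y, v). frechet_derivative \<Phi> (at (t, y)) (1, v))"
proof -
  let ?D = "\<lambda>z. frechet_derivative \<Phi> (at z)"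
  have expand: "?D z (1, v) = ?D z (1, 0) + (\<Sum>i\<in>UNIV. v $ i * ?D z (0, axis i 1))" for z v
  proof -
    note lin = has_derivative_linear[OF smooth_has_derivative[OF assms, of z]]
    have "(\<Sum>i\<in>UNIV. v $ i *\<^sub>R (0 :: real, axis i 1 :: real ^ 'n)) = (0, v)"
      using basis_expansion[of v] by (simp add: sum_prod scalar_mult_eq_scaleR)
    then have "?D z (0, v) = ?D z (\<Sum>i\<in>UNIV. v $ i *\<^sub>R (0, axis i 1))" by simp
    also have "\<dots> = (\<Sum>i\<in>UNIV. v $ i * ?D z (0, axis i 1))"
      by (simp add: linear_sum[OF lin] linear_scale[OF lin] del: scaleR_Pair)
    finally show ?thesis using linear_add[OF lin, of "(1, 0)" "(0, v)"] by simp
  qed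
  have "(\<lambda>(t, y, v). ?D (t, y) (1, v)) = (\<lambda>p. ?D (fst p, fst (snd p)) (1, snd (snd p)))" by auto
  also have "\<dots> = (\<lambda>p. ?D (fst p, fst (snd p)) (1, 0) +
      (\<Sum>i\<in>UNIV. snd (snd p) $ i * ?D (fst p, fst (snd p)) (0, axis i 1)))"
    by (rule ext) (rule expand)
  finally have eq: "(\<lambda>(t, y, v). ?D (t, y) (1, v)) = \<dots>" .
  show ?thesis
    unfolding eq
    by (intro continuous_intros continuous_on_compose2[OF smooth_continuous[OF smooth_derivative[OF assms]]]) auto
qed

section \<open>Lower bound by smooth subsolutions\<close>

lemma action_ge:
  assumes f: "has_bochner_integral \<rho> f I" and le: "\<And>t x v. (t, x, v) \<in> space \<rho> \<Longrightarrow> f (t, x, v) \<le> L x v"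
  shows "ereal I \<le> action L \<rho>"
proof -
  have int: "integrable \<rho> f" and I: "integral\<^sup>L \<rho> f = I" using f by (auto simp: has_bochner_integral_iff)
  let ?p = "\<integral>\<^sup>+ z. ennreal (f z) \<partial>\<rho>" and ?n = "\<integral>\<^sup>+ z. ennreal (- f z) \<partial>\<rho>"
  have fin: "?p < \<infinity>" "?n < \<infinity>"
    using int by (auto simp: real_integrable_def less_top)
  have "ereal I = enn2ereal ?p - enn2ereal ?n"
    using real_lebesgue_integral_def[OF int] I fin
    by (cases ?p; cases ?n) (auto simp: enn2ereal_ennreal)
  also have "\<dots> \<le> action L \<rho>"
    unfolding action_def
  proof (rule ereal_minus_mono)
    show "enn2ereal ?p \<le> enn2ereal (\<integral>\<^sup>+ (t, x, v). ennreal (L x v) \<partial>\<rho>)"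
      unfolding less_eq_ennreal.rep_eq[symmetric] using le
      by (intro nn_integral_mono) (auto intro!: ennreal_leI)
    show "enn2ereal (\<integral>\<^sup>+ (t, x, v). ennreal (- L x v) \<partial>\<rho>) \<le> enn2ereal ?n"
      unfolding less_eq_ennreal.rep_eq[symmetric] using le
      by (intro nn_integral_mono) (auto intro!: ennreal_leI)
  qed
  finally show ?thesis .
qed

lemma action_eq:
  assumes "has_bochner_integral \<rho> (\<lambda>(t, x, v). L x v) I"
  shows "action L \<rho> = ereal I"
proof -
  let ?f = "\<lambda>(t, x, v). L x v"
  have int: "integrable \<rho> ?f" and I: "integral\<^sup>L \<rho> ?f = I"
    using assms by (auto simp: has_bochner_integral_iff)
  let ?p = "\<integral>\<^sup>+ z. ennreal (?f z) \<partial>\<rho>" and ?n = "\<integral>\<^sup>+ z. ennreal (- ?f z) \<partial>\<rho>"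
  have fin: "?p < \<infinity>" "?n < \<infinity>"
    using int by (auto simp: real_integrable_def less_top)
  have "ereal I = enn2ereal ?p - enn2ereal ?n"
    using real_lebesgue_integral_def[OF int] I fin
    by (cases ?p; cases ?n) (auto simp: enn2ereal_ennreal)
  then show ?thesis by (simp add: action_def split_beta')
qed

lemma space_Pi_meas: "\<rho> \<in> Pi_meas T \<theta> Q \<Longrightarrow> space \<rho> = {0..T} \<times> UNIV"
  unfolding Pi_meas_def by (auto dest!: sets_eq_imp_space_eq simp: space_restrict_space)

text \<open>Weak duality: the test functions \<open>\<Phi>\<close> and \<open>t\<close>, together with the constraint on the mean of \<open>v\<close>, give the
  integral over \<open>\<rho>\<close> of a function that lies below \<open>L\<close>.\<close>

lemma gQ_ge_subsolution:
  fixes L :: "'n::finite torus \<Rightarrow> real ^ 'n \<Rightarrow> real" and \<Phi> :: "real \<times> (real ^ 'n) \<Rightarrow> real"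
  assumes "smooth \<Phi>"
    and per: "\<And>t y y'. torus_rel y y' \<Longrightarrow> \<Phi> (t, y) = \<Phi> (t, y')"
    and sub: "\<And>t y v. 0 \<le> t \<Longrightarrow> t \<le> T \<Longrightarrow>
      frechet_derivative \<Phi> (at (t, y)) (1, v) \<le> L (abs_torus y) v - p \<bullet> v + \<epsilon>"
  shows "ereal (\<Phi> (T, y0) - \<Phi> (0, y0) + p \<bullet> Q - \<epsilon> * T) \<le> gQ L T Q (return borel (abs_torus y0))"
  unfolding gQ_def
proof (rule INF_greatest)
  fix \<rho> assume \<rho>: "\<rho> \<in> Pi_meas T (return borel (abs_torus y0)) Q"
  have test: "has_bochner_integral \<rho> (\<lambda>(t, x, v). frechet_derivative \<Psi> (at (t, rep_torus x)) (1, v))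
      (\<Psi> (T, y0) - \<Psi> (0, y0))"
    if \<Psi>: "smooth \<Psi>" and per: "\<And>t y y'. torus_rel y y' \<Longrightarrow> \<Psi> (t, y) = \<Psi> (t, y')"
    for \<Psi> :: "real \<times> (real ^ 'n) \<Rightarrow> real"
  proof -
    define \<phi> where "\<phi> t x = \<Psi> (t, rep_torus x)" for t x
    have eq: "\<phi> t (abs_torus y) = \<Psi> (t, y)" for t y
      unfolding \<phi>_def by (rule per[OF rep_abs_torus])
    then have eq': "(\<lambda>(t, y). \<phi> t (abs_torus y)) = \<Psi>" by auto
    have "continuous_on UNIV (\<lambda>x. \<phi> T x - \<phi> 0 x)"
    proof (rule continuous_torusI)
      show "continuous_on UNIV (\<lambda>y. \<phi> T (abs_torus y) - \<phi> 0 (abs_torus y))"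
        unfolding eq by (intro continuous_intros continuous_on_compose2[OF smooth_continuous[OF \<Psi>]]) auto
    qed
    then have m: "(\<lambda>x. \<phi> T x - \<phi> 0 x) \<in> borel_measurable borel"
      by (rule borel_measurable_continuous_onI)
    have "has_bochner_integral \<rho> (\<lambda>(t, x, v). deriv (\<lambda>s. \<phi> s x) t + v \<bullet> torus_grad (\<phi> t) x)
          (\<integral>x. \<phi> T x - \<phi> 0 x \<partial>return borel (abs_torus y0))"
      using \<rho> \<Psi> unfolding Pi_meas_def eq'[symmetric] by blast
    then show ?thesis
      using m by (simp add: test_integrand_eq eq' \<Psi> integral_return eq)
  qed
  \<comment> \<open>The test function \<open>t\<close>, which gives the total mass.\<close>
  have "smooth (\<lambda>z :: real \<times> (real ^ 'n). z \<bullet> (1, 0) + 0)"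
    unfolding smooth_def by (intro allI Ck_compose_affine[where g = "\<lambda>r. r"]) (rule Ck_id)
  then have "has_bochner_integral \<rho>
      (\<lambda>(t, x, v). frechet_derivative (\<lambda>z :: real \<times> (real ^ 'n). z \<bullet> (1, 0) + 0) (at (t, rep_torus x)) (1, v)) T"
    using test[of "\<lambda>z. z \<bullet> (1, 0) + 0"] by simp
  moreover have "frechet_derivative (\<lambda>z :: real \<times> (real ^ 'n). z \<bullet> (1, 0) + 0) (at z) = (\<lambda>z. z \<bullet> (1, 0))" for z
    by (rule frechet_derivative_at[symmetric]) (auto intro!: derivative_eq_intros)
  ultimately have mass: "has_bochner_integral \<rho> (\<lambda>(t, x, v). 1) T" by simp
  have v: "has_bochner_integral \<rho> (\<lambda>(t, x, v). v) Q" using \<rho> by (simp add: Pi_meas_def)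
  show "ereal (\<Phi> (T, y0) - \<Phi> (0, y0) + p \<bullet> Q - \<epsilon> * T) \<le> action L \<rho>"
  proof (rule action_ge)
    show "has_bochner_integral \<rho>
      (\<lambda>z. (\<lambda>(t, x, v). frechet_derivative \<Phi> (at (t, rep_torus x)) (1, v)) z
         + p \<bullet> (\<lambda>(t, x, v). v) z - \<epsilon> * (\<lambda>(t, x, v). 1) z)
      (\<Phi> (T, y0) - \<Phi> (0, y0) + p \<bullet> Q - \<epsilon> * T)"
      by (intro has_bochner_integral_add has_bochner_integral_diff has_bochner_integral_inner_right
          has_bochner_integral_mult_right test[OF assms(1) per] mass v)
    show "(\<lambda>(t, x, v). frechet_derivative \<Phi> (at (t, rep_torus x)) (1, v)) (t, x, v)
         + p \<bullet> (\<lambda>(t, x, v). v) (t, x, v) - \<epsilon> * (\<lambda>(t, x, v). 1) (t, x, v) \<le> L x v"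
      if "(t, x, v) \<in> space \<rho>" for t x v
      using sub[of t "rep_torus x" v] that space_Pi_meas[OF \<rho>] by auto
  qed
qed

section \<open>Measures carried by bundles of segments\<close>

text \<open>An index \<open>j\<close> describes a segment run through with velocity \<open>v j\<close> from time \<open>\<tau> j\<close> on during time \<open>h j\<close>,
  and \<open>x\<close> in the torus moves along it from the position \<open>x + a j\<close>; \<open>W j x\<close> is the share of \<open>x\<close> that
  uses it. Time is clamped to \<open>{0..T}\<close> so that the map lands in the right space everywhere; for
  segments that stay in this interval, it has no effect where the density does not vanish.\<close>

definition segment_measure :: "real \<Rightarrow> 'n::finite torus measure \<Rightarrow> 'j set \<Rightarrow> ('j \<Rightarrow> 'n torus \<Rightarrow> real) \<Rightarrow>
    ('j \<Rightarrow> real) \<Rightarrow> ('j \<Rightarrow> real ^ 'n) \<Rightarrow> ('j \<Rightarrow> real) \<Rightarrow> ('j \<Rightarrow> real ^ 'n) \<Rightarrow>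
    (real \<times> 'n torus \<times> (real ^ 'n)) measure" where
  "segment_measure T \<theta> J W \<tau> a h v = distr
     (density (\<theta> \<Otimes>\<^sub>M (count_space J \<Otimes>\<^sub>M restrict_space lborel {0..T}))
       (\<lambda>(x, j, s). ennreal (W j x * indicator {0..h j} s)))
     (restrict_space borel ({0..T} \<times> UNIV \<times> UNIV))
     (\<lambda>(x, j, s). (max 0 (min T (\<tau> j + s)), abs_torus (frac_rep x + a j + s *\<^sub>R v j), v j))"

text \<open>Fubini's theorem. Integrability holds because the velocities are finitely many, so that the lift \<open>F\<close> is
  evaluated on a compact set only.\<close>

lemma has_bochner_integral_segment_measure:
  fixes F :: "real \<times> (real ^ 'n::finite) \<times> (real ^ 'n) \<Rightarrow> 'b::euclidean_space"
    and J :: "'j set"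
  assumes \<theta>: "\<theta> \<in> borel_probs" and J: "finite J" and T: "0 \<le> T"
    and W: "\<And>j. j \<in> J \<Longrightarrow> W j \<in> borel_measurable \<theta>" "\<And>j x. j \<in> J \<Longrightarrow> 0 \<le> W j x" "\<And>j x. j \<in> J \<Longrightarrow> W j x \<le> 1"
    and \<tau>: "\<And>j. j \<in> J \<Longrightarrow> 0 \<le> \<tau> j" "\<And>j. j \<in> J \<Longrightarrow> 0 \<le> h j" "\<And>j. j \<in> J \<Longrightarrow> \<tau> j + h j \<le> T"
    and F: "continuous_on UNIV F" and f: "\<And>t y v. f (t, abs_torus y, v) = F (t, y, v)"
  shows "has_bochner_integral (segment_measure T \<theta> J W \<tau> a h v) f
    (\<integral>x. (\<Sum>j\<in>J. W j x *\<^sub>R integral {0..h j} (\<lambda>s. F (\<tau> j + s, frac_rep x + a j + s *\<^sub>R v j, v j))) \<partial>\<theta>)"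
proof -
  let ?lb = "restrict_space lborel {0..T}"
  let ?N = "count_space J \<Otimes>\<^sub>M ?lb"
  let ?M = "\<theta> \<Otimes>\<^sub>M ?N"
  interpret \<theta>: prob_space \<theta> using \<theta> by (simp add: borel_probs_def)
  interpret count: finite_measure "count_space J" by (rule finite_measure_count_space[OF J])
  interpret lb: finite_measure ?lb
    by (rule finite_measureI) (use T in \<open>simp add: space_restrict_space emeasure_restrict_space\<close>)
  interpret N: finite_measure ?N
    by (intro finite_measure_pair_measure count.finite_measure_axioms lb.finite_measure_axioms)
  interpret M: finite_measure ?M
    by (intro finite_measure_pair_measure N.finite_measure_axioms \<theta>.finite_measure_axioms)
  interpret N: pair_sigma_finite "count_space J" ?lb ..
  interpret M: pair_sigma_finite \<theta> ?N ..
  have sets_\<theta> [measurable_cong]: "sets \<theta> = sets borel" using \<theta> by (simp add: borel_probs_def)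
  have fr [measurable]: "frac_rep \<in> borel_measurable \<theta>"
    using borel_measurable_frac_rep by (simp cong: measurable_cong_sets add: sets_\<theta>)
  have cnt [measurable]: "g \<in> count_space J \<rightarrow>\<^sub>M borel" for g :: "'j \<Rightarrow> 'c::topological_space"
    by simp
  have s [measurable]: "(\<lambda>s. s) \<in> ?lb \<rightarrow>\<^sub>M borel"
    by (rule measurable_restrict_space1) simp
  define P where "P z = (max 0 (min T (\<tau> (fst (snd z)) + snd (snd z))),
      frac_rep (fst z) + a (fst (snd z)) + snd (snd z) *\<^sub>R v (fst (snd z)), v (fst (snd z)))" for z
  have P: "P \<in> ?M \<rightarrow>\<^sub>M borel"
    unfolding P_def by measurable
  let ?abs = "\<lambda>p :: real \<times> (real ^ 'n) \<times> (real ^ 'n). (fst p, abs_torus (fst (snd p)), snd (snd p))"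
  have "?abs \<in> borel \<rightarrow>\<^sub>M borel"
    by (intro borel_measurable_continuous_onI continuous_intros continuous_on_compose2[OF continuous_abs_torus]) auto
  note G0 = measurable_compose[OF P this]
  let ?G = "\<lambda>(x, j, s). (max 0 (min T (\<tau> j + s)), abs_torus (frac_rep x + a j + s *\<^sub>R v j), v j)"
  have Geq: "?G = (\<lambda>z. ?abs (P z))" by (auto simp: P_def)
  have G: "?G \<in> ?M \<rightarrow>\<^sub>M restrict_space borel ({0..T} \<times> UNIV \<times> UNIV)"
    unfolding Geq by (rule measurable_restrict_space2[OF _ G0]) (use T in \<open>auto simp: P_def\<close>)
  let ?w = "\<lambda>(x, j, s). W j x * indicator {0..h j} s"
  have w: "?w \<in> borel_measurable ?M"
  proof -
    have "(\<lambda>z. W (fst (snd z)) (fst z)) \<in> borel_measurable ?M"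
      by (rule measurable_compose_countable'[where I = J and f = "\<lambda>j z. W j (fst z)"])
        (use W(1) J in \<open>auto intro: countable_finite measurable_compose[OF measurable_fst]\<close>)
    moreover have "(\<lambda>z. indicator {0..h (fst (snd z))} (snd (snd z)) :: real) \<in> borel_measurable ?M"
      by (rule measurable_compose_countable'[where I = J and f = "\<lambda>j z. indicator {0..h j} (snd (snd z))"])
        (use J in \<open>auto intro: countable_finite\<close>)
    ultimately show ?thesis by (simp add: case_prod_beta)
  qed
  have FP: "(\<lambda>z. F (P z)) \<in> borel_measurable ?M"
    by (rule measurable_compose[OF P borel_measurable_continuous_onI[OF F]])
  let ?g = "\<lambda>z. ?w z *\<^sub>R F (P z)"
  have g: "?g \<in> borel_measurable ?M" using w FP by measurable
  have "\<exists>C. \<forall>z\<in>space ?M. norm (?g z) \<le> C"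
  proof -
    let ?r = "norm (One :: real ^ 'n) + (\<Sum>j\<in>J. norm (a j)) + T * (\<Sum>j\<in>J. norm (v j))"
    have "compact (F ` ({0..T} \<times> cball 0 ?r \<times> v ` J))"
      using J by (intro compact_continuous_image compact_Times continuous_on_subset[OF F]) (auto intro: finite_imp_compact)
    then obtain C where C: "0 < C" "\<forall>z \<in> F ` ({0..T} \<times> cball 0 ?r \<times> v ` J). norm z \<le> C"
      using compact_imp_bounded bounded_pos by metis
    have "norm (?g (x, j, s)) \<le> C" if z: "j \<in> J" "0 \<le> s" "s \<le> T" for x j s
    proof -
      have "norm (frac_rep x + a j + s *\<^sub>R v j) \<le> norm (frac_rep x) + norm (a j) + norm (s *\<^sub>R v j)"
        using norm_triangle_ineq[of "frac_rep x + a j" "s *\<^sub>R v j"] norm_triangle_ineq[of "frac_rep x" "a j"] by linarith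
      also have "norm (frac_rep x) \<le> norm (One :: real ^ 'n)"
        using frac_rep_cbox[of x] by (intro norm_le_componentwise) (auto simp: mem_box)
      also have "norm (a j) \<le> (\<Sum>j\<in>J. norm (a j))" using J z(1) by (intro member_le_sum) auto
      also have "norm (s *\<^sub>R v j) \<le> T * (\<Sum>j\<in>J. norm (v j))"
        using J z T by (auto intro!: mult_mono member_le_sum)
      finally have "P (x, j, s) \<in> {0..T} \<times> cball 0 ?r \<times> v ` J"
        using z T by (auto simp: P_def)
      then have "norm (F (P (x, j, s))) \<le> C"
        by (intro C(2)[rule_format] imageI)
      moreover have "\<bar>?w (x, j, s)\<bar> \<le> 1" using W(2)[OF z(1), of x] W(3)[OF z(1), of x] by (auto simp: indicator_def)
      ultimately have "\<bar>?w (x, j, s)\<bar> * norm (F (P (x, j, s))) \<le> 1 * C"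
        by (intro mult_mono) auto
      then show ?thesis by simp
    qed
    then show ?thesis
      by (intro exI[of _ C]) (auto simp: space_pair_measure space_restrict_space)
  qed
  then obtain C where C: "\<And>z. z \<in> space ?M \<Longrightarrow> norm (?g z) \<le> C" by blast
  have intg: "integrable ?M ?g"
    by (rule M.integrable_const_bound[OF AE_I2 g]) (rule C)
  have inner: "(\<integral>q. ?g (x, q) \<partial>?N) =
      (\<Sum>j\<in>J. W j x *\<^sub>R integral {0..h j} (\<lambda>s. F (\<tau> j + s, frac_rep x + a j + s *\<^sub>R v j, v j)))"
    if x: "x \<in> space \<theta>" for x
  proof -
    have gx: "(\<lambda>q. ?g (x, q)) \<in> borel_measurable ?N"
      by (rule measurable_compose[OF measurable_Pair1'[OF x] g])
    have "integrable ?N (\<lambda>q. ?g (x, q))"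
      by (rule N.integrable_const_bound[OF AE_I2 gx]) (use C x in \<open>auto simp: space_pair_measure\<close>)
    then have "(\<integral>q. ?g (x, q) \<partial>?N) = (\<integral>j. \<integral>s. ?g (x, j, s) \<partial>?lb \<partial>count_space J)"
      using N.integral_fst'[of "\<lambda>q. ?g (x, q)"] by simp
    also have "\<dots> = (\<Sum>j\<in>J. \<integral>s. ?g (x, j, s) \<partial>?lb)"
      by (rule lebesgue_integral_count_space_finite[OF J])
    also have "\<dots> = (\<Sum>j\<in>J. W j x *\<^sub>R integral {0..h j} (\<lambda>s. F (\<tau> j + s, frac_rep x + a j + s *\<^sub>R v j, v j)))"
    proof (rule sum.cong[OF refl])
      fix j assume j: "j \<in> J"
      let ?F = "\<lambda>s. F (\<tau> j + s, frac_rep x + a j + s *\<^sub>R v j, v j)"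
      have contF: "continuous_on {0..h j} ?F"
        by (rule continuous_on_compose2[OF F]) (auto intro!: continuous_intros)
      have "set_integrable lborel {0..h j} ?F"
        unfolding set_integrable_def by (rule borel_integrable_compact[OF compact_Icc contF])
      note hk = set_borel_integral_eq_integral(2)[OF this]
      have "(\<integral>s. ?g (x, j, s) \<partial>?lb) = (\<integral>s. indicator {0..T} s *\<^sub>R ?g (x, j, s) \<partial>lborel)"
        by (rule integral_restrict_space) simp
      also have "\<dots> = (\<integral>s. W j x *\<^sub>R (indicator {0..h j} s *\<^sub>R ?F s) \<partial>lborel)"
      proof (rule Bochner_Integration.integral_cong[OF refl])
        fix s
        show "indicator {0..T} s *\<^sub>R ?g (x, j, s) = W j x *\<^sub>R (indicator {0..h j} s *\<^sub>R ?F s)"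
        proof (cases "s \<in> {0..h j}")
          case True
          then have "max 0 (min T (\<tau> j + s)) = \<tau> j + s" "s \<in> {0..T}" using \<tau>[OF j] by auto
          then show ?thesis using True by (simp add: P_def)
        qed simp
      qed
      also have "\<dots> = W j x *\<^sub>R integral {0..h j} ?F"
        unfolding hk[symmetric] set_lebesgue_integral_def
        by (rule Bochner_Integration.integral_scaleR_right)
      finally show "(\<integral>s. ?g (x, j, s) \<partial>?lb) = W j x *\<^sub>R integral {0..h j} ?F" .
    qed
    finally show ?thesis .
  qed
  have "has_bochner_integral ?M ?g (\<integral>x. \<integral>q. ?g (x, q) \<partial>?N \<partial>\<theta>)"
    using intg M.integral_fst'[OF intg] by (simp add: has_bochner_integral_iff)
  also have "(\<integral>x. \<integral>q. ?g (x, q) \<partial>?N \<partial>\<theta>) =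
    (\<integral>x. (\<Sum>j\<in>J. W j x *\<^sub>R integral {0..h j} (\<lambda>s. F (\<tau> j + s, frac_rep x + a j + s *\<^sub>R v j, v j))) \<partial>\<theta>)"
    by (rule Bochner_Integration.integral_cong[OF refl inner])
  finally have main: "has_bochner_integral ?M ?g
    (\<integral>x. (\<Sum>j\<in>J. W j x *\<^sub>R integral {0..h j} (\<lambda>s. F (\<tau> j + s, frac_rep x + a j + s *\<^sub>R v j, v j))) \<partial>\<theta>)" .
  have fG: "f (?G z) = F (P z)" for z
    using f[of "fst (P z)" "fst (snd (P z))" "snd (snd (P z))"] by (simp add: Geq)
  have dens: "(\<lambda>(x, j, s). ennreal (W j x * indicator {0..h j} s)) = (\<lambda>z. ennreal (?w z))" by auto
  show ?thesis
    unfolding segment_measure_def dens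
  proof (intro has_bochner_integral_distr has_bochner_integral_density)
    show "f \<in> borel_measurable (restrict_space borel ({0..T} \<times> UNIV \<times> UNIV))"
      by (rule measurable_restrict_space1[OF lift_borel_measurable[OF F f]])
    show "?G \<in> density ?M (\<lambda>z. ennreal (?w z)) \<rightarrow>\<^sub>M restrict_space borel ({0..T} \<times> UNIV \<times> UNIV)"
      using G by simp
    show "(\<lambda>z. f (?G z)) \<in> borel_measurable ?M" unfolding fG by (rule FP)
    show "?w \<in> borel_measurable ?M" by (rule w)
    show "AE z in ?M. 0 \<le> ?w z"
      using W(2) by (intro AE_I2) (auto simp: space_pair_measure)
    show "has_bochner_integral ?M (\<lambda>z. ?w z *\<^sub>R f (?G z))
      (\<integral>x. (\<Sum>j\<in>J. W j x *\<^sub>R integral {0..h j} (\<lambda>s. F (\<tau> j + s, frac_rep x + a j + s *\<^sub>R v j, v j))) \<partial>\<theta>)"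
      unfolding fG by (rule main)
  qed
qed

section \<open>Bundles of closed polygons\<close>

lemma forward_nth: "forward l \<Longrightarrow> m < length l \<Longrightarrow> 0 \<le> fst (l ! m)"
  by (simp add: forward_def)

lemma take_Suc_last:
  assumes "m < length l"
  shows "dur (take (Suc m) l) = dur (take m l) + fst (l ! m)"
    and "disp (take (Suc m) l) = disp (take m l) + fst (l ! m) *\<^sub>R snd (l ! m)"
  using assms by (simp_all add: take_Suc_conv_app_nth)

lemma dur_take_le:
  fixes l :: "'a::real_vector polygon"
  assumes "forward l" "m < length l"
  shows "0 \<le> dur (take m l)" "dur (take m l) + fst (l ! m) \<le> dur l"
proof -
  have fw: "forward (take k l)" "forward (drop k l)" for k
    using assms(1) by (auto simp: forward_def dest: in_set_takeD in_set_dropD)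
  show "0 \<le> dur (take m l)" by (rule dur_nonneg[OF fw(1)])
  have "dur (take (Suc m) l) + dur (drop (Suc m) l) = dur l"
    by (metis append_take_drop_id dur_append)
  then show "dur (take m l) + fst (l ! m) \<le> dur l"
    using dur_nonneg[OF fw(2), of "Suc m"] take_Suc_last(1)[OF assms(2)] by linarith
qed

lemma cost_eq_sum:
  "cost \<l> y l = (\<Sum>m<length l. integral {0..fst (l ! m)} (\<lambda>s. \<l> (y + disp (take m l) + s *\<^sub>R snd (l ! m)) (snd (l ! m))))"
  by (induction l arbitrary: y) (simp_all add: sum.lessThan_Suc_shift add.assoc del: sum.lessThan_Suc)

lemma disp_eq_sum: "disp l = (\<Sum>m<length l. fst (l ! m) *\<^sub>R snd (l ! m))"
  by (induction l) (simp_all add: sum.lessThan_Suc_shift del: sum.lessThan_Suc)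

text \<open>The fundamental theorem of calculus on each segment, summed telescopically.\<close>

lemma increment_eq_sum:
  fixes \<Phi> :: "real \<times> 'a::euclidean_space \<Rightarrow> real"
  assumes "smooth \<Phi>" "forward l"
  shows "(\<Sum>m<length l. integral {0..fst (l ! m)} (\<lambda>s. frechet_derivative \<Phi>
      (at (dur (take m l) + s, y + disp (take m l) + s *\<^sub>R snd (l ! m))) (1, snd (l ! m))))
    = \<Phi> (dur l, y + disp l) - \<Phi> (0, y)"
proof -
  have "integral {0..fst (l ! m)} (\<lambda>s. frechet_derivative \<Phi>
      (at (dur (take m l) + s, y + disp (take m l) + s *\<^sub>R snd (l ! m))) (1, snd (l ! m)))
    = \<Phi> (dur (take (Suc m) l), y + disp (take (Suc m) l)) - \<Phi> (dur (take m l), y + disp (take m l))"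
    if m: "m < length l" for m
  proof -
    let ?c = "\<lambda>s. (dur (take m l) + s, y + disp (take m l) + s *\<^sub>R snd (l ! m))"
    have "((\<lambda>s. frechet_derivative \<Phi> (at (?c s)) (1, snd (l ! m))) has_integral
        (\<Phi> (?c (fst (l ! m))) - \<Phi> (?c 0))) {0..fst (l ! m)}"
    proof (rule fundamental_theorem_of_calculus)
      show "0 \<le> fst (l ! m)" by (rule forward_nth[OF assms(2) m])
      fix s
      have D: "(\<Phi> has_derivative frechet_derivative \<Phi> (at (?c s))) (at (?c s))"
        by (rule smooth_has_derivative[OF assms(1)])
      have "((\<lambda>s. \<Phi> (?c s)) has_derivative (\<lambda>r. frechet_derivative \<Phi> (at (?c s)) (r, r *\<^sub>R snd (l ! m)))) (at s)"
        by (rule has_derivative_compose[where f = ?c and g = \<Phi>, OF _ D]) (auto intro!: derivative_eq_intros)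
      moreover have "frechet_derivative \<Phi> (at (?c s)) (r, r *\<^sub>R snd (l ! m)) =
          r *\<^sub>R frechet_derivative \<Phi> (at (?c s)) (1, snd (l ! m))" for r
        using linear_scale[OF has_derivative_linear[OF D], of r "(1, snd (l ! m))"] by simp
      ultimately show "((\<lambda>s. \<Phi> (?c s)) has_vector_derivative frechet_derivative \<Phi> (at (?c s)) (1, snd (l ! m)))
          (at s within {0..fst (l ! m)})"
        by (simp add: has_vector_derivative_def has_derivative_at_withinI)
    qed
    then show ?thesis
      using take_Suc_last[OF m] by (simp add: integral_unique add.assoc)
  qed
  then have "(\<Sum>m<length l. integral {0..fst (l ! m)} (\<lambda>s. frechet_derivative \<Phi>
      (at (dur (take m l) + s, y + disp (take m l) + s *\<^sub>R snd (l ! m))) (1, snd (l ! m))))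
    = (\<Sum>m<length l. \<Phi> (dur (take (Suc m) l), y + disp (take (Suc m) l)) - \<Phi> (dur (take m l), y + disp (take m l)))"
    by (intro sum.cong) auto
  also have "\<dots> = \<Phi> (dur l, y + disp l) - \<Phi> (0, y)"
    by (subst sum_lessThan_telescope) simp
  finally show ?thesis .
qed

definition loops :: "real \<Rightarrow> (real ^ 'n::finite) polygon set" where
  "loops T = {l. forward l \<and> dur l = T \<and> torus_rel (disp l) 0}"

text \<open>Pairs of mean displacement and mean cost of finite convex combinations of closed polygons based at
  \<open>y\<close>. Which polygons are closed does not depend on \<open>y\<close>; only their costs do.\<close>

definition loop_hull :: "(real ^ 'n::finite \<Rightarrow> real ^ 'n \<Rightarrow> real) \<Rightarrow> real \<Rightarrow> real ^ 'n \<Rightarrow> ((real ^ 'n) \<times> real) set" where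
  "loop_hull \<l> T y = convex hull ((\<lambda>l. (disp l, cost \<l> y l)) ` loops T)"

lemma loop_hullE:
  assumes "(Q, c) \<in> loop_hull \<l> T y"
  obtains K \<mu> where "finite K" "K \<subseteq> loops T" "\<And>l. l \<in> K \<Longrightarrow> 0 \<le> \<mu> l" "sum \<mu> K = 1"
    "(\<Sum>l\<in>K. \<mu> l *\<^sub>R disp l) = Q" "(\<Sum>l\<in>K. \<mu> l * cost \<l> y l) = c"
proof -
  let ?f = "\<lambda>l. (disp l, cost \<l> y l)"
  obtain S u where S: "finite S" "S \<subseteq> ?f ` loops T" "\<forall>x\<in>S. 0 \<le> u x" "sum u S = 1"
    "(\<Sum>x\<in>S. u x *\<^sub>R x) = (Q, c)"
    using assms unfolding loop_hull_def convex_hull_explicit by auto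
  obtain K where K: "K \<subseteq> loops T" "inj_on ?f K" "S = ?f ` K"
    using S(2) by (auto simp: subset_image_inj)
  have sum: "(\<Sum>l\<in>K. u (?f l) *\<^sub>R ?f l) = (Q, c)"
    using S(5) K by (simp add: sum.reindex)
  show thesis
  proof
    show "finite K" using S(1) K by (simp add: finite_image_iff)
    show "(\<Sum>l\<in>K. u (?f l)) = 1" using S(4) K by (simp add: sum.reindex)
    show "(\<Sum>l\<in>K. u (?f l) *\<^sub>R disp l) = Q" "(\<Sum>l\<in>K. u (?f l) * cost \<l> y l) = c"
      using arg_cong[OF sum, of fst] arg_cong[OF sum, of snd] by (simp_all add: fst_sum snd_sum)
  qed (use S(3) K in auto)
qed

lemma loop_hullI:
  assumes "finite K" "K \<subseteq> loops T" "\<And>l. l \<in> K \<Longrightarrow> 0 \<le> \<mu> l" "sum \<mu> K = 1"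
  shows "((\<Sum>l\<in>K. \<mu> l *\<^sub>R disp l), (\<Sum>l\<in>K. \<mu> l * cost \<l> y l)) \<in> loop_hull \<l> T y"
proof -
  have "(\<Sum>l\<in>K. \<mu> l *\<^sub>R (disp l, cost \<l> y l)) \<in> loop_hull \<l> T y"
    unfolding loop_hull_def
    using assms by (intro convex_sum[OF _ convex_convex_hull]) (auto intro: hull_inc)
  then show ?thesis by (simp add: sum_prod)
qed

lemma stay_in_loops: "0 < T \<Longrightarrow> [(T, 0)] \<in> loops T"
  by (simp add: loops_def)

lemma integer_loop:
  assumes "0 < T" "torus_rel k 0"
  shows "[(T, (1 / T) *\<^sub>R k)] \<in> loops T"
  using assms by (simp add: loops_def)

context periodic_lagrangian
begin

lemma loop_hull_ge: "\<exists>B. \<forall>Q c y. (Q, c) \<in> loop_hull \<l> T y \<longrightarrow> B \<le> c"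
proof -
  obtain B where B: "\<forall>y l. forward l \<longrightarrow> - (B * dur l) \<le> cost \<l> y l"
    using cost_ge by (elim exE)
  have "loop_hull \<l> T y \<subseteq> {z. (0, 1) \<bullet> z \<ge> - (B * T)}" for y
    unfolding loop_hull_def
  proof (rule hull_minimal)
    show "(\<lambda>l. (disp l, cost \<l> y l)) ` loops T \<subseteq> {z. (0, 1) \<bullet> z \<ge> - (B * T)}"
      using B by (auto simp: loops_def)
  qed (rule convex_halfspace_ge)
  from subsetD[OF this] show ?thesis by (intro exI[of _ "- (B * T)"]) fastforce
qed

text \<open>The separating hyperplane between the vertical set \<open>{Q} \<times> C\<close> and the hull cannot be vertical,
  because closed polygons have arbitrary integral displacements, on both sides of any hyperplane; so it is
  the graph of an affine function with slope \<open>p\<close>. The case \<open>C = UNIV\<close> is absurd and shows that some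
  combination has mean displacement \<open>Q\<close>; the case of a half line is used for the lower bound.\<close>

lemma separating_momentum:
  assumes T: "0 < T" and C: "convex C" "C \<noteq> {}" "\<And>c. c \<in> C \<Longrightarrow> {..c} \<subseteq> C"
    and disj: "\<And>c. c \<in> C \<Longrightarrow> (Q, c) \<notin> loop_hull \<l> T y"
  obtains p where "\<And>l c. l \<in> loops T \<Longrightarrow> c \<in> C \<Longrightarrow> c - p \<bullet> Q \<le> cost \<l> y l - p \<bullet> disp l"
proof -
  have "convex ({Q} \<times> C)" "{Q} \<times> C \<noteq> {}" using C by (auto simp: convex_Times)
  moreover have "loop_hull \<l> T y \<noteq> {}"
    using stay_in_loops[OF T] unfolding loop_hull_def by auto
  moreover have "convex (loop_hull \<l> T y)" by (simp add: loop_hull_def)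
  moreover have "{Q} \<times> C \<inter> loop_hull \<l> T y = {}" using disj by auto
  ultimately obtain a b where ab: "a \<noteq> 0" "\<forall>z\<in>{Q} \<times> C. a \<bullet> z \<le> b" "\<forall>z\<in>loop_hull \<l> T y. b \<le> a \<bullet> z"
    using separating_hyperplane_sets[of "{Q} \<times> C" "loop_hull \<l> T y"] by blast
  obtain q \<alpha> where a: "a = (q, \<alpha>)" by fastforce
  have le: "q \<bullet> Q + \<alpha> * c \<le> b" if "c \<in> C" for c using ab(2) that by (auto simp: a)
  have ge: "b \<le> q \<bullet> disp l + \<alpha> * cost \<l> y l" if "l \<in> loops T" for l
    using ab(3) that by (auto simp: a loop_hull_def intro!: hull_inc dest!: bspec[of _ _ "(disp l, cost \<l> y l)"])
  obtain c0 where c0: "c0 \<in> C" using C(2) by blast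
  have "0 \<le> \<alpha>"
  proof (rule ccontr)
    assume neg: "\<not> 0 \<le> \<alpha>"
    define c where "c = min c0 ((b - q \<bullet> Q + 1) / \<alpha>)"
    have "c \<in> C" using C(3)[OF c0] by (auto simp: c_def)
    have "b - q \<bullet> Q + 1 \<le> \<alpha> * c"
      using neg by (simp add: c_def min_def field_simps split: if_splits)
    with le[OF \<open>c \<in> C\<close>] show False by simp
  qed
  moreover have "\<alpha> \<noteq> 0"
  proof
    assume "\<alpha> = 0"
    then have "q \<noteq> 0" using ab(1) a by (auto simp: zero_prod_def)
    then obtain i where i: "q $ i \<noteq> 0" by (auto simp: vec_eq_iff)
    obtain M :: nat where M: "\<bar>q \<bullet> Q\<bar> < of_nat M * \<bar>q $ i\<bar>"
      using i reals_Archimedean3[of "\<bar>q $ i\<bar>"] by auto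
    define k where "k = (- sgn (q $ i) * of_nat M) *\<^sub>R (axis i 1 :: real ^ 'n)"
    have "torus_rel k 0"
      by (auto simp: torus_rel_def k_def axis_def sgn_if)
    from ge[OF integer_loop[OF T this]] le[OF c0] \<open>\<alpha> = 0\<close> T
    have "q \<bullet> Q \<le> q \<bullet> k" by simp
    also have "q \<bullet> k = - (of_nat M * \<bar>q $ i\<bar>)"
      by (simp add: k_def inner_axis abs_sgn mult_ac)
    finally show False using M by linarith
  qed
  ultimately have \<alpha>: "0 < \<alpha>" by simp
  show thesis
  proof
    fix l :: "(real ^ 'n) polygon" and c assume "l \<in> loops T" "c \<in> C"
    then have "q \<bullet> Q + \<alpha> * c \<le> q \<bullet> disp l + \<alpha> * cost \<l> y l"
      using le ge by (meson order_trans)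
    then have "(q \<bullet> Q + \<alpha> * c) / \<alpha> \<le> (q \<bullet> disp l + \<alpha> * cost \<l> y l) / \<alpha>"
      using \<alpha> by (simp add: divide_right_mono)
    then show "c - (- (1 / \<alpha>) *\<^sub>R q) \<bullet> Q \<le> cost \<l> y l - (- (1 / \<alpha>) *\<^sub>R q) \<bullet> disp l"
      using \<alpha> by (simp add: add_divide_distrib)
  qed
qed

definition loop_cost :: "real \<Rightarrow> real ^ 'n \<Rightarrow> real ^ 'n \<Rightarrow> real" where
  "loop_cost T Q y = Inf {c. (Q, c) \<in> loop_hull \<l> T y}"

lemma loop_hull_nonempty:
  assumes "0 < T"
  shows "\<exists>c. (Q, c) \<in> loop_hull \<l> T y"
proof (rule ccontr)
  assume "\<not> ?thesis"
  then obtain p where p: "\<And>l c. l \<in> loops T \<Longrightarrow> c \<in> UNIV \<Longrightarrow> c - p \<bullet> Q \<le> cost \<l> y l - p \<bullet> disp l"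
    using separating_momentum[OF assms, of UNIV Q y] by auto
  from p[OF stay_in_loops[OF assms] UNIV_I, of "cost \<l> y [(T, 0)] + p \<bullet> Q + 1"] show False by simp
qed

lemma bdd_below_loop_hull: "bdd_below {c. (Q, c) \<in> loop_hull \<l> T y}"
  using loop_hull_ge[of T] unfolding bdd_below_def by blast

lemma loop_cost_less_iff:
  assumes "0 < T"
  shows "loop_cost T Q y < m \<longleftrightarrow> (\<exists>c<m. (Q, c) \<in> loop_hull \<l> T y)"
  unfolding loop_cost_def
  by (subst cInf_less_iff) (use loop_hull_nonempty bdd_below_loop_hull assms in auto)

lemma loop_cost_periodic: "torus_rel y y' \<Longrightarrow> loop_cost T Q y = loop_cost T Q y'"
  by (simp add: loop_cost_def loop_hull_def cost_periodic[of y y'])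

lemma continuous_average_cost: "continuous_on UNIV (\<lambda>z. \<Sum>l\<in>K. \<mu> l * cost \<l> z l)"
  by (intro continuous_intros continuous_cost)

text \<open>A combination that is good at \<open>y\<close> remains good, with the same polygons and weights, at nearby points.
  Hence the optimal cost is upper semicontinuous, and it attains its maximum on the torus.\<close>

lemma open_loop_cost_less:
  assumes "0 < T"
  shows "open {y. loop_cost T Q y < m}"
proof (subst open_subopen, intro ballI)
  fix y assume "y \<in> {y. loop_cost T Q y < m}"
  then obtain c where c: "c < m" "(Q, c) \<in> loop_hull \<l> T y"
    using loop_cost_less_iff[OF assms] by auto
  from c(2) obtain K \<mu> where K: "finite K" "K \<subseteq> loops T" "\<And>l. l \<in> K \<Longrightarrow> 0 \<le> \<mu> l" "sum \<mu> K = 1"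
    "(\<Sum>l\<in>K. \<mu> l *\<^sub>R disp l) = Q" "(\<Sum>l\<in>K. \<mu> l * cost \<l> y l) = c"
    by (rule loop_hullE) blast
  let ?N = "{z. (\<Sum>l\<in>K. \<mu> l * cost \<l> z l) < m}"
  have "open ?N" by (intro open_Collect_less continuous_average_cost continuous_on_const)
  moreover have "y \<in> ?N" using K(6) c(1) by simp
  moreover have "?N \<subseteq> {y. loop_cost T Q y < m}"
    using loop_hullI[OF K(1-4)] K(5) loop_cost_less_iff[OF assms] by auto
  ultimately show "\<exists>N. open N \<and> y \<in> N \<and> N \<subseteq> {y. loop_cost T Q y < m}" by blast
qed

lemma loop_cost_attains_max:
  assumes "0 < T"
  obtains y0 where "\<And>y. loop_cost T Q y \<le> loop_cost T Q y0"
proof -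
  let ?X = "cbox 0 One :: (real ^ 'n) set"
  have "\<exists>y0\<in>?X. \<forall>y\<in>?X. loop_cost T Q y \<le> loop_cost T Q y0"
  proof (rule ccontr)
    assume "\<not> ?thesis"
    then obtain f where f: "\<And>y. y \<in> ?X \<Longrightarrow> f y \<in> ?X \<and> loop_cost T Q y < loop_cost T Q (f y)"
      by (metis not_le)
    let ?U = "\<lambda>y. {z. loop_cost T Q z < loop_cost T Q (f y)}"
    obtain F where F: "F \<subseteq> ?X" "finite F" "?X \<subseteq> (\<Union>y\<in>F. ?U y)"
    proof (rule compactE_image[of ?X ?X ?U])
      show "?X \<subseteq> (\<Union>y\<in>?X. ?U y)" using f by blast
    qed (auto intro: open_loop_cost_less[OF assms])
    have "(0 :: real ^ 'n) \<in> ?X" by (auto simp: mem_box)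
    then have "F \<noteq> {}" using F(3) by auto
    define M where "M = Max ((\<lambda>y. loop_cost T Q (f y)) ` F)"
    have "M \<in> (\<lambda>y. loop_cost T Q (f y)) ` F" unfolding M_def using F \<open>F \<noteq> {}\<close> by (intro Max_in) auto
    then obtain y where y: "y \<in> F" "M = loop_cost T Q (f y)" by auto
    then obtain z where "z \<in> F" "loop_cost T Q (f y) < loop_cost T Q (f z)"
      using f F by blast
    moreover have "loop_cost T Q (f z) \<le> M" unfolding M_def using F(2) \<open>z \<in> F\<close> by (intro Max_ge) auto
    ultimately show False using y by simp
  qed
  then obtain y0 where y0: "\<And>y. y \<in> ?X \<Longrightarrow> loop_cost T Q y \<le> loop_cost T Q y0" by blast
  show thesis
  proof
    fix y
    obtain z where "torus_rel z y" "z - 0 \<in> ?X" by (rule torus_rel_cube)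
    then show "loop_cost T Q y \<le> loop_cost T Q y0"
      using y0[of z] loop_cost_periodic by simp
  qed
qed

end

section \<open>Upper bound by bundles of closed polygons\<close>

definition bundle_measure :: "real \<Rightarrow> 'n::finite torus measure \<Rightarrow> nat \<Rightarrow> ('n torus \<Rightarrow> nat) \<Rightarrow>
    (nat \<Rightarrow> (real ^ 'n) polygon set) \<Rightarrow> (nat \<Rightarrow> (real ^ 'n) polygon \<Rightarrow> real) \<Rightarrow>
    (real \<times> 'n torus \<times> (real ^ 'n)) measure" where
  "bundle_measure T \<theta> N idx K \<mu> = segment_measure T \<theta>
     (SIGMA i:{..<N}. SIGMA l:K i. {..<length l})
     (\<lambda>(i, l, m) x. if idx x = i then \<mu> i l else 0)
     (\<lambda>(i, l, m). dur (take m l)) (\<lambda>(i, l, m). disp (take m l))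
     (\<lambda>(i, l, m). fst (l ! m)) (\<lambda>(i, l, m). snd (l ! m))"

text \<open>Every point \<open>x\<close> of the torus is assigned, through the index \<open>idx x\<close>, one of finitely many convex
  combinations of closed polygons with mean displacement \<open>Q\<close>.\<close>

locale loop_bundle =
  fixes T :: real and \<theta> :: "'n::finite torus measure" and N :: nat and idx :: "'n torus \<Rightarrow> nat"
    and K :: "nat \<Rightarrow> (real ^ 'n) polygon set" and \<mu> :: "nat \<Rightarrow> (real ^ 'n) polygon \<Rightarrow> real" and Q :: "real ^ 'n"
  assumes T: "0 < T" and \<theta>: "\<theta> \<in> borel_probs"
    and idx: "idx \<in> \<theta> \<rightarrow>\<^sub>M count_space UNIV" "\<And>x. idx x < N"
    and K: "\<And>i. i < N \<Longrightarrow> finite (K i)" "\<And>i. i < N \<Longrightarrow> K i \<subseteq> loops T"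
    and \<mu>: "\<And>i l. i < N \<Longrightarrow> l \<in> K i \<Longrightarrow> 0 \<le> \<mu> i l" "\<And>i. i < N \<Longrightarrow> sum (\<mu> i) (K i) = 1"
    and mean: "\<And>i. i < N \<Longrightarrow> (\<Sum>l\<in>K i. \<mu> i l *\<^sub>R disp l) = Q"
begin

abbreviation \<rho> where "\<rho> \<equiv> bundle_measure T \<theta> N idx K \<mu>"

lemma has_bochner_integral_bundle:
  fixes F :: "real \<times> (real ^ 'n) \<times> (real ^ 'n) \<Rightarrow> 'b::euclidean_space"
  assumes F: "continuous_on UNIV F" and f: "\<And>t y v. f (t, abs_torus y, v) = F (t, y, v)"
  shows "has_bochner_integral \<rho> f (\<integral>x. (\<Sum>l\<in>K (idx x). \<mu> (idx x) l *\<^sub>R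
    (\<Sum>m<length l. integral {0..fst (l ! m)}
      (\<lambda>s. F (dur (take m l) + s, frac_rep x + disp (take m l) + s *\<^sub>R snd (l ! m), snd (l ! m))))) \<partial>\<theta>)"
proof -
  let ?J = "SIGMA i:{..<N}. SIGMA l:K i. {..<length l}"
  let ?S = "\<lambda>x l m. integral {0..fst (l ! m)}
      (\<lambda>s. F (dur (take m l) + s, frac_rep x + disp (take m l) + s *\<^sub>R snd (l ! m), snd (l ! m)))"
  have fw: "forward l" "dur l = T" if "i < N" "l \<in> K i" for i l
    using K(2)[OF that(1)] that(2) by (auto simp: loops_def)
  have \<mu>1: "\<mu> i l \<le> 1" if "i < N" "l \<in> K i" for i l
    using member_le_sum[OF that(2), of "\<mu> i"] \<mu> K that by auto
  have mW: "(\<lambda>x. if idx x = i then \<mu> i l else 0) \<in> borel_measurable \<theta>" for i l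
    using measurable_compose[OF idx(1), of "\<lambda>k. if k = i then \<mu> i l else 0" borel] by simp
  have "has_bochner_integral \<rho> f (\<integral>x. (\<Sum>j\<in>?J. (case j of (i, l, m) \<Rightarrow> \<lambda>x. if idx x = i then \<mu> i l else 0) x *\<^sub>R
     integral {0..(case j of (i, l, m) \<Rightarrow> fst (l ! m))} (\<lambda>s. F ((case j of (i, l, m) \<Rightarrow> dur (take m l)) + s,
       frac_rep x + (case j of (i, l, m) \<Rightarrow> disp (take m l)) + s *\<^sub>R (case j of (i, l, m) \<Rightarrow> snd (l ! m)),
       (case j of (i, l, m) \<Rightarrow> snd (l ! m))))) \<partial>\<theta>)"
    unfolding bundle_measure_def
  proof (rule has_bochner_integral_segment_measure[OF \<theta> _ _ _ _ _ _ _ _ F f])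
    show "finite ?J" using K(1) by auto
    show "0 \<le> T" using T by simp
    fix j assume j: "j \<in> ?J"
    then obtain i l m where [simp]: "j = (i, l, m)" and m: "i < N" "l \<in> K i" "m < length l" by auto
    show "(case j of (i, l, m) \<Rightarrow> \<lambda>x. if idx x = i then \<mu> i l else 0) \<in> borel_measurable \<theta>"
      using mW by simp
    show "0 \<le> (case j of (i, l, m) \<Rightarrow> \<lambda>x. if idx x = i then \<mu> i l else 0) x"
      "(case j of (i, l, m) \<Rightarrow> \<lambda>x. if idx x = i then \<mu> i l else 0) x \<le> 1" for x
      using \<mu>(1) \<mu>1 m by auto
    show "0 \<le> (case j of (i, l, m) \<Rightarrow> dur (take m l))"
      "0 \<le> (case j of (i, l, m) \<Rightarrow> fst (l ! m))"
      "(case j of (i, l, m) \<Rightarrow> dur (take m l)) + (case j of (i, l, m) \<Rightarrow> fst (l ! m)) \<le> T"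
      using dur_take_le[OF fw(1) m(3)] forward_nth[OF fw(1) m(3)] fw(2) m by auto
  qed
  also have "(\<lambda>x. \<Sum>j\<in>?J. (case j of (i, l, m) \<Rightarrow> \<lambda>x. if idx x = i then \<mu> i l else 0) x *\<^sub>R
     integral {0..(case j of (i, l, m) \<Rightarrow> fst (l ! m))} (\<lambda>s. F ((case j of (i, l, m) \<Rightarrow> dur (take m l)) + s,
       frac_rep x + (case j of (i, l, m) \<Rightarrow> disp (take m l)) + s *\<^sub>R (case j of (i, l, m) \<Rightarrow> snd (l ! m)),
       (case j of (i, l, m) \<Rightarrow> snd (l ! m))))) =
    (\<lambda>x. \<Sum>l\<in>K (idx x). \<mu> (idx x) l *\<^sub>R (\<Sum>m<length l. ?S x l m))" (is "?A = ?B")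
  proof
    fix x
    have "?A x = (\<Sum>(i, l, m)\<in>?J. (if idx x = i then \<mu> i l else 0) *\<^sub>R ?S x l m)"
      by (intro sum.cong) auto
    also have "\<dots> = (\<Sum>i<N. \<Sum>(l, m)\<in>(SIGMA l:K i. {..<length l}). (if idx x = i then \<mu> i l else 0) *\<^sub>R ?S x l m)"
      using K(1) by (subst sum.Sigma) (auto simp: case_prod_beta)
    also have "\<dots> = (\<Sum>i<N. \<Sum>l\<in>K i. \<Sum>m<length l. (if idx x = i then \<mu> i l else 0) *\<^sub>R ?S x l m)"
      using K(1) by (intro sum.cong[OF refl]) (subst sum.Sigma, auto simp: case_prod_beta)
    also have "\<dots> = (\<Sum>i<N. if i = idx x then (\<Sum>l\<in>K i. \<mu> i l *\<^sub>R (\<Sum>m<length l. ?S x l m)) else 0)"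
      by (intro sum.cong[OF refl]) (auto simp: scaleR_sum_right)
    also have "\<dots> = ?B x" using idx(2)[of x] by simp
    finally show "?A x = ?B x" .
  qed
  finally show ?thesis .
qed

text \<open>All polygons close up on the torus, so every point is back where it started at time \<open>T\<close> and the
  boundary terms reproduce \<open>\<theta>\<close>, whatever \<open>\<theta>\<close> is.\<close>

lemma bundle_in_Pi_meas: "\<rho> \<in> Pi_meas T \<theta> Q"
proof -
  interpret \<theta>: prob_space \<theta> using \<theta> by (simp add: borel_probs_def)
  have loop: "dur l = T" "abs_torus (frac_rep x + disp l) = x" "forward l" if "l \<in> K (idx x)" for l x
  proof -
    have l: "l \<in> loops T" using K(2)[OF idx(2)] that by blast
    then show "dur l = T" "forward l" by (auto simp: loops_def)
    have "torus_rel (frac_rep x + disp l) (frac_rep x)"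
      using l torus_rel_add[of "disp l" 0 "frac_rep x"] by (simp add: loops_def add.commute)
    then show "abs_torus (frac_rep x + disp l) = x" using abs_torus_eq_iff abs_frac_rep by metis
  qed
  have test: "has_bochner_integral \<rho> (\<lambda>(t, x, v). deriv (\<lambda>s. \<phi> s x) t + v \<bullet> torus_grad (\<phi> t) x)
      (\<integral>x. \<phi> T x - \<phi> 0 x \<partial>\<theta>)"
    if smooth: "smooth (\<lambda>(t, y). \<phi> t (abs_torus y))" for \<phi> :: "real \<Rightarrow> 'n torus \<Rightarrow> real"
  proof -
    define \<Phi> where "\<Phi> = (\<lambda>(t, y). \<phi> t (abs_torus y))"
    have \<Phi>: "smooth \<Phi>" using smooth by (simp add: \<Phi>_def)
    let ?F = "\<lambda>(t, y, v). frechet_derivative \<Phi> (at (t, y)) (1, v)"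
    have "has_bochner_integral \<rho> (\<lambda>(t, x, v). deriv (\<lambda>s. \<phi> s x) t + v \<bullet> torus_grad (\<phi> t) x)
      (\<integral>x. (\<Sum>l\<in>K (idx x). \<mu> (idx x) l *\<^sub>R
      (\<Sum>m<length l. integral {0..fst (l ! m)}
      (\<lambda>s. ?F (dur (take m l) + s, frac_rep x + disp (take m l) + s *\<^sub>R snd (l ! m), snd (l ! m))))) \<partial>\<theta>)"
    proof (rule has_bochner_integral_bundle[OF continuous_derivative_pairing[OF \<Phi>]])
      fix t :: real and y v :: "real ^ 'n"
      let ?w = "(0 :: real, rep_torus (abs_torus y) - y)"
      have "\<Phi> (z + ?w) = \<Phi> z" for z
      proof -
        have "torus_rel (snd z + (rep_torus (abs_torus y) - y)) (snd z)"
          using torus_rel_add[OF rep_abs_torus[of y], of "snd z - y"] by (simp add: algebra_simps)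
        then have "abs_torus (snd z + (rep_torus (abs_torus y) - y)) = abs_torus (snd z)"
          by (rule abs_torus_eq_iff[THEN iffD2])
        then show ?thesis by (simp add: \<Phi>_def case_prod_beta)
      qed
      from periodic_derivative[OF this smooth_has_derivative[OF \<Phi>], of "(t, y)"]
      show "(case (t, abs_torus y, v) of (t, x, v) \<Rightarrow> deriv (\<lambda>s. \<phi> s x) t + v \<bullet> torus_grad (\<phi> t) x) = ?F (t, y, v)"
        using test_integrand_eq[OF smooth] by (simp add: \<Phi>_def[symmetric])
    qed
    also have "(\<integral>x. (\<Sum>l\<in>K (idx x). \<mu> (idx x) l *\<^sub>R
      (\<Sum>m<length l. integral {0..fst (l ! m)}
      (\<lambda>s. ?F (dur (take m l) + s, frac_rep x + disp (take m l) + s *\<^sub>R snd (l ! m), snd (l ! m))))) \<partial>\<theta>)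
      = (\<integral>x. \<phi> T x - \<phi> 0 x \<partial>\<theta>)"
    proof (rule Bochner_Integration.integral_cong[OF refl])
      fix x
      have "(\<Sum>l\<in>K (idx x). \<mu> (idx x) l *\<^sub>R (\<Sum>m<length l. integral {0..fst (l ! m)}
        (\<lambda>s. ?F (dur (take m l) + s, frac_rep x + disp (take m l) + s *\<^sub>R snd (l ! m), snd (l ! m)))))
        = (\<Sum>l\<in>K (idx x). \<mu> (idx x) l *\<^sub>R (\<phi> T x - \<phi> 0 x))"
        using increment_eq_sum[OF \<Phi> loop(3)] loop(1,2)
        by (intro sum.cong[OF refl]) (simp add: \<Phi>_def)
      also have "\<dots> = \<phi> T x - \<phi> 0 x"
        using \<mu>(2)[OF idx(2)] by (simp flip: sum_distrib_right)
      finally show "(\<Sum>l\<in>K (idx x). \<mu> (idx x) l *\<^sub>R (\<Sum>m<length l. integral {0..fst (l ! m)}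
        (\<lambda>s. ?F (dur (take m l) + s, frac_rep x + disp (take m l) + s *\<^sub>R snd (l ! m), snd (l ! m)))))
        = \<phi> T x - \<phi> 0 x" .
    qed
    finally show ?thesis .
  qed
  have "has_bochner_integral \<rho> (\<lambda>(t, x, v). v) (\<integral>x. (\<Sum>l\<in>K (idx x). \<mu> (idx x) l *\<^sub>R
    (\<Sum>m<length l. integral {0..fst (l ! m)}
      (\<lambda>s. (\<lambda>(t, y, v). v) (dur (take m l) + s, frac_rep x + disp (take m l) + s *\<^sub>R snd (l ! m), snd (l ! m))))) \<partial>\<theta>)"
    by (rule has_bochner_integral_bundle) (auto simp: case_prod_beta intro!: continuous_intros)
  also have "(\<integral>x. (\<Sum>l\<in>K (idx x). \<mu> (idx x) l *\<^sub>R
    (\<Sum>m<length l. integral {0..fst (l ! m)}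
      (\<lambda>s. (\<lambda>(t, y, v). v) (dur (take m l) + s, frac_rep x + disp (take m l) + s *\<^sub>R snd (l ! m), snd (l ! m))))) \<partial>\<theta>)
    = (\<integral>x. Q \<partial>\<theta>)"
  proof (rule Bochner_Integration.integral_cong[OF refl])
    fix x
    have "(\<Sum>m<length l. integral {0..fst (l ! m)} (\<lambda>s. snd (l ! m))) = disp l" if "l \<in> K (idx x)" for l
      unfolding disp_eq_sum using forward_nth[OF loop(3)[OF that]] by (intro sum.cong) auto
    then show "(\<Sum>l\<in>K (idx x). \<mu> (idx x) l *\<^sub>R (\<Sum>m<length l. integral {0..fst (l ! m)}
      (\<lambda>s. (\<lambda>(t, y, v). v) (dur (take m l) + s, frac_rep x + disp (take m l) + s *\<^sub>R snd (l ! m), snd (l ! m))))) = Q"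
      using mean[OF idx(2)] by simp
  qed
  finally have v: "has_bochner_integral \<rho> (\<lambda>(t, x, v). v) Q" by (simp add: \<theta>.prob_space)
  have "sets \<rho> = sets (restrict_space borel ({0..T} \<times> UNIV \<times> UNIV))"
    by (simp add: bundle_measure_def segment_measure_def)
  then show ?thesis using test v by (simp add: Pi_meas_def)
qed

lemma gQ_le_bundle:
  assumes pl: "periodic_lagrangian (\<lambda>y v. L (abs_torus y) v)"
    and m: "\<And>x. (\<Sum>l\<in>K (idx x). \<mu> (idx x) l * cost (\<lambda>y v. L (abs_torus y) v) (frac_rep x) l) \<le> m"
  shows "gQ L T Q \<theta> \<le> ereal m"
proof -
  let ?l = "\<lambda>y v. L (abs_torus y) v"
  interpret periodic_lagrangian ?l by (rule pl)
  interpret \<theta>: prob_space \<theta> using \<theta> by (simp add: borel_probs_def)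
  let ?c = "\<lambda>x. \<Sum>l\<in>K (idx x). \<mu> (idx x) l * cost ?l (frac_rep x) l"
  have "has_bochner_integral \<rho> (\<lambda>(t, x, v). L x v) (\<integral>x. (\<Sum>l\<in>K (idx x). \<mu> (idx x) l *\<^sub>R
    (\<Sum>m<length l. integral {0..fst (l ! m)}
      (\<lambda>s. (\<lambda>(t, y, v). ?l y v) (dur (take m l) + s, frac_rep x + disp (take m l) + s *\<^sub>R snd (l ! m), snd (l ! m))))) \<partial>\<theta>)"
    by (rule has_bochner_integral_bundle) (auto simp: case_prod_beta intro!: continuous_intros)
  also have "(\<lambda>x. \<Sum>l\<in>K (idx x). \<mu> (idx x) l *\<^sub>R
    (\<Sum>m<length l. integral {0..fst (l ! m)}
      (\<lambda>s. (\<lambda>(t, y, v). ?l y v) (dur (take m l) + s, frac_rep x + disp (take m l) + s *\<^sub>R snd (l ! m), snd (l ! m))))) = ?c"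
    by (simp add: cost_eq_sum)
  finally have "action L \<rho> = ereal (\<integral>x. ?c x \<partial>\<theta>)" by (rule action_eq)
  moreover have "(\<integral>x. ?c x \<partial>\<theta>) \<le> m"
  proof (rule \<theta>.integral_le_const)
    obtain B where B: "\<forall>y l. forward l \<longrightarrow> - (B * dur l) \<le> cost ?l y l" using cost_ge by (elim exE)
    have lower: "- (B * T) \<le> ?c x" for x
    proof -
      have "- (B * T) = (\<Sum>l\<in>K (idx x). \<mu> (idx x) l * - (B * T))"
        using \<mu>(2)[OF idx(2)[of x]] by (simp add: sum_negf flip: sum_distrib_right)
      also have "\<dots> \<le> ?c x"
        using B K(2)[OF idx(2)] \<mu>(1)[OF idx(2)]
        by (intro sum_mono mult_left_mono) (auto simp: loops_def subset_iff)
      finally show ?thesis .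
    qed
    show "integrable \<theta> ?c"
    proof (rule \<theta>.integrable_const_bound[where B = "\<bar>B * T\<bar> + \<bar>m\<bar>"])
      show "AE x in \<theta>. norm (?c x) \<le> \<bar>B * T\<bar> + \<bar>m\<bar>"
        using lower m by (intro AE_I2) (smt (verit, best) real_norm_def)
      have fr: "frac_rep \<in> borel_measurable \<theta>"
        using borel_measurable_frac_rep \<theta> by (simp add: borel_probs_def cong: measurable_cong_sets)
      have "(\<lambda>x. \<Sum>l\<in>K i. \<mu> i l * cost ?l (frac_rep x) l) \<in> borel_measurable \<theta>" for i
        by (rule measurable_compose[OF fr borel_measurable_continuous_onI[OF continuous_average_cost]])
      then show "?c \<in> borel_measurable \<theta>"
        by (rule measurable_compose_countable[OF _ idx(1)])
    qed
    show "AE x in \<theta>. ?c x \<le> m" using m by simp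
  qed
  ultimately show ?thesis
    unfolding gQ_def using INF_lower[OF bundle_in_Pi_meas, of "action L"] by (auto intro: order_trans)
qed

end

text \<open>Nearby points can use the same combination of polygons, and the torus is compact, so finitely many
  combinations suffice and the assignment can be made constant on the pieces of a finite Borel
  partition. This takes the place of a measurable selection of optimal combinations.\<close>

lemma gQ_le:
  fixes L :: "'n::finite torus \<Rightarrow> real ^ 'n \<Rightarrow> real"
  assumes pl: "periodic_lagrangian (\<lambda>y v. L (abs_torus y) v)" and T: "0 < T" and \<theta>: "\<theta> \<in> borel_probs"
    and m: "\<And>y. periodic_lagrangian.loop_cost (\<lambda>y v. L (abs_torus y) v) T Q y < m"
  shows "gQ L T Q \<theta> \<le> ereal m"
proof -
  let ?l = "\<lambda>y v. L (abs_torus y) v"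
  interpret periodic_lagrangian ?l by (rule pl)
  define P where "P y K \<mu> \<longleftrightarrow> finite K \<and> K \<subseteq> loops T \<and> (\<forall>l\<in>K. 0 \<le> \<mu> l) \<and> sum \<mu> K = 1 \<and>
      (\<Sum>l\<in>K. \<mu> l *\<^sub>R disp l) = Q \<and> (\<Sum>l\<in>K. \<mu> l * cost ?l y l) < m" for y K \<mu>
  have "\<exists>K \<mu>. P y K \<mu>" for y
  proof -
    obtain c where c: "c < m" "(Q, c) \<in> loop_hull ?l T y" using loop_cost_less_iff[OF T] m by blast
    from c(2) obtain K \<mu> where "finite K" "K \<subseteq> loops T" "\<And>l. l \<in> K \<Longrightarrow> 0 \<le> \<mu> l" "sum \<mu> K = 1"
      "(\<Sum>l\<in>K. \<mu> l *\<^sub>R disp l) = Q" "(\<Sum>l\<in>K. \<mu> l * cost ?l y l) = c"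
      by (rule loop_hullE) blast
    then show ?thesis using c(1) by (auto simp: P_def)
  qed
  then obtain K \<mu> where "\<And>y. P y (K y) (\<mu> y)" by metis
  then have K: "finite (K y)" "K y \<subseteq> loops T" "\<forall>l\<in>K y. 0 \<le> \<mu> y l" "sum (\<mu> y) (K y) = 1"
    "(\<Sum>l\<in>K y. \<mu> y l *\<^sub>R disp l) = Q" "(\<Sum>l\<in>K y. \<mu> y l * cost ?l y l) < m" for y
    unfolding P_def by blast+
  define V where "V y = {z. (\<Sum>l\<in>K y. \<mu> y l * cost ?l z l) < m}" for y
  have V: "open (V y)" "y \<in> V y" for y
    unfolding V_def using K(6) by (auto intro!: open_Collect_less continuous_average_cost continuous_on_const)
  let ?X = "cbox 0 One :: (real ^ 'n) set"
  obtain F where F: "F \<subseteq> ?X" "finite F" "?X \<subseteq> (\<Union>y\<in>F. V y)"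
    by (rule compactE_image[of ?X ?X V]) (use V in auto)
  obtain ys where ys: "set ys = F" using finite_list[OF F(2)] by blast
  define idx where "idx x = (LEAST i. frac_rep x \<in> V (ys ! i))" for x
  have idx_less: "idx x < length ys" and idx_V: "frac_rep x \<in> V (ys ! idx x)" for x
  proof -
    obtain y where "y \<in> F" "frac_rep x \<in> V y" using F(3) frac_rep_cbox[of x] by blast
    then obtain i where i: "i < length ys" "frac_rep x \<in> V (ys ! i)" using ys by (auto simp: in_set_conv_nth)
    show "idx x < length ys" unfolding idx_def using Least_le[of "\<lambda>i. frac_rep x \<in> V (ys ! i)", OF i(2)] i(1) by simp
    show "frac_rep x \<in> V (ys ! idx x)" unfolding idx_def by (rule LeastI[of _ i]) (rule i(2))
  qed
  have "idx \<in> \<theta> \<rightarrow>\<^sub>M count_space UNIV"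
  proof -
    have [measurable]: "frac_rep \<in> borel_measurable \<theta>"
      using borel_measurable_frac_rep \<theta> by (simp add: borel_probs_def cong: measurable_cong_sets)
    have [measurable]: "V y \<in> sets borel" for y using V(1) by simp
    show ?thesis unfolding idx_def by measurable
  qed
  then interpret loop_bundle T \<theta> "length ys" idx "\<lambda>i. K (ys ! i)" "\<lambda>i. \<mu> (ys ! i)" Q
    by unfold_locales (use T \<theta> idx_less K in auto)
  show ?thesis
    by (rule gQ_le_bundle[OF pl]) (use idx_V in \<open>auto simp: V_def less_imp_le\<close>)
qed

section \<open>Lower bound at a point\<close>

lemma (in periodic_lagrangian) tilt: "periodic_lagrangian (\<lambda>y v. \<l> y v - p \<bullet> v)"
proof
  show "continuous_on UNIV (\<lambda>(y, v). \<l> y v - p \<bullet> v)"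
    by (auto simp: case_prod_beta intro!: continuous_intros)
  show "\<l> y v - p \<bullet> v = \<l> y' v - p \<bullet> v" if "torus_rel y y'" for y y' v
    using periodic[OF that] by simp
  show "convex_on UNIV (\<lambda>v. \<l> y v - p \<bullet> v)" for y
    using convex[of y] by (auto simp: convex_on_def algebra_simps)
  show "\<exists>B. \<forall>y v. A * norm v - B \<le> \<l> y v - p \<bullet> v" for A
  proof -
    obtain B where B: "\<And>y v. (A + norm p) * norm v - B \<le> \<l> y v" using superlinear by blast
    have "A * norm v - B \<le> \<l> y v - p \<bullet> v" for y v
      using B[of v y] norm_cauchy_schwarz[of p v] by (simp add: distrib_right)
    then show ?thesis by blast
  qed
qed

lemma (in periodic_lagrangian) cost_tilt:
  "forward l \<Longrightarrow> cost (\<lambda>y v. \<l> y v - p \<bullet> v) y l = cost \<l> y l - p \<bullet> disp l"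
proof (induction l arbitrary: y)
  case (Cons q l)
  have "integral {0..fst q} (\<lambda>s. \<l> (y + s *\<^sub>R snd q) (snd q) - p \<bullet> snd q) =
      integral {0..fst q} (\<lambda>s. \<l> (y + s *\<^sub>R snd q) (snd q)) - integral {0..fst q} (\<lambda>s. p \<bullet> snd q)"
    by (rule Henstock_Kurzweil_Integration.integral_diff[OF integrable_segment integrable_const_ivl])
  then show ?case
    using Cons by (simp add: inner_add_right)
qed simp

text \<open>A slope \<open>p\<close> that separates the hull from the values up to \<open>c0\<close>, slightly below the optimum, turns the constrained problem at \<open>y0\<close> into the unconstrained one for
  \<open>L - p \<bullet> v\<close>, for which every closed polygon costs at least \<open>c0 - p \<bullet> Q\<close>; smooth subsolutions of that
  problem bound the action from below.\<close>

lemma gQ_ge: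
  fixes L :: "'n::finite torus \<Rightarrow> real ^ 'n \<Rightarrow> real"
  assumes pl: "periodic_lagrangian (\<lambda>y v. L (abs_torus y) v)" and T: "0 < T"
  shows "ereal (periodic_lagrangian.loop_cost (\<lambda>y v. L (abs_torus y) v) T Q y0)
    \<le> gQ L T Q (return borel (abs_torus y0))"
proof -
  let ?l = "\<lambda>y v. L (abs_torus y) v"
  interpret periodic_lagrangian ?l by (rule pl)
  have *: "ereal (loop_cost T Q y0 - \<epsilon> - \<epsilon> - \<epsilon> * T) \<le> gQ L T Q (return borel (abs_torus y0))"
    if \<epsilon>: "0 < \<epsilon>" for \<epsilon>
  proof -
    define c0 where "c0 = loop_cost T Q y0 - \<epsilon>"
    have "(Q, c) \<notin> loop_hull ?l T y0" if "c \<in> {..c0}" for c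
      using loop_cost_less_iff[OF T, of Q y0 "loop_cost T Q y0"] that \<epsilon> by (auto simp: c0_def)
    then obtain p where p: "\<And>l c. l \<in> loops T \<Longrightarrow> c \<in> {..c0} \<Longrightarrow> c - p \<bullet> Q \<le> cost ?l y0 l - p \<bullet> disp l"
      using separating_momentum[OF T, of "{..c0}" Q y0] by auto
    interpret tilted: periodic_lagrangian "\<lambda>y v. ?l y v - p \<bullet> v" by (rule tilt)
    have "c0 - p \<bullet> Q \<le> cost (\<lambda>y v. ?l y v - p \<bullet> v) y0 l"
      if "forward l" "dur l = T" "torus_rel (disp l) 0" for l
      using p[of l c0] that by (simp add: cost_tilt loops_def)
    from tilted.smooth_subsolution[OF T \<epsilon> this]
    obtain \<Phi> :: "real \<times> (real ^ 'n) \<Rightarrow> real" where \<Phi>: "smooth \<Phi>"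
      "\<And>t x x'. torus_rel x x' \<Longrightarrow> \<Phi> (t, x) = \<Phi> (t, x')"
      "\<And>t x v. 0 \<le> t \<Longrightarrow> t \<le> T \<Longrightarrow> frechet_derivative \<Phi> (at (t, x)) (1, v) \<le> ?l x v - p \<bullet> v + \<epsilon>"
      "(c0 - p \<bullet> Q) - \<epsilon> \<le> \<Phi> (T, y0) - \<Phi> (0, y0)"
      by blast
    have "ereal (\<Phi> (T, y0) - \<Phi> (0, y0) + p \<bullet> Q - \<epsilon> * T) \<le> gQ L T Q (return borel (abs_torus y0))"
      by (rule gQ_ge_subsolution[OF \<Phi>(1-3)])
    moreover have "loop_cost T Q y0 - \<epsilon> - \<epsilon> - \<epsilon> * T \<le> \<Phi> (T, y0) - \<Phi> (0, y0) + p \<bullet> Q - \<epsilon> * T"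
      using \<Phi>(4) by (simp add: c0_def)
    ultimately show ?thesis by (meson ereal_less_eq(3) order_trans)
  qed
  show ?thesis
  proof (rule ereal_le_epsilon2)
    fix e :: real assume e: "0 < e"
    define \<epsilon> where "\<epsilon> = e / (2 + T)"
    have \<epsilon>: "0 < \<epsilon>" "\<epsilon> * (2 + T) = e" using T e by (simp_all add: \<epsilon>_def)
    then have "loop_cost T Q y0 - \<epsilon> - \<epsilon> - \<epsilon> * T = loop_cost T Q y0 - e"
      by (simp add: algebra_simps)
    then have "ereal (loop_cost T Q y0 - e) \<le> gQ L T Q (return borel (abs_torus y0))"
      using *[OF \<epsilon>(1)] by (simp only:)
    then have "ereal (loop_cost T Q y0 - e) + ereal e \<le> gQ L T Q (return borel (abs_torus y0)) + ereal e"
      by (rule add_right_mono)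
    then show "ereal (loop_cost T Q y0) \<le> gQ L T Q (return borel (abs_torus y0)) + ereal e" by simp
  qed
qed

section \<open>Tonelli Lagrangians on the torus\<close>

text \<open>The point to prove is that superlinear growth is uniform in the position. At one point \<open>y0\<close> coercivity
  provides a sphere on which \<open>L\<close> exceeds its value at \<open>0\<close> by more than \<open>A * r\<close>; by compactness of the
  sphere this persists near \<open>y0\<close>, and by convexity along rays it propagates to all larger velocities.\<close>

lemma lagrangian_periodic:
  fixes L :: "'n::finite torus \<Rightarrow> real ^ 'n \<Rightarrow> real"
  assumes "lagrangian L"
  shows "periodic_lagrangian (\<lambda>y v. L (abs_torus y) v)"
proof
  let ?l = "\<lambda>y v. L (abs_torus y) v"
  show cont: "continuous_on UNIV (\<lambda>(y, v). ?l y v)"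
    using assms by (auto simp: lagrangian_def intro: smooth_continuous)
  have cont2: "continuous_on S (\<lambda>s. ?l (f s) (g s))" if "continuous_on S f" "continuous_on S g"
    for S and f g :: "(real ^ 'n) \<times> (real ^ 'n) \<Rightarrow> real ^ 'n"
    using continuous_on_compose2[OF cont, of S "\<lambda>s. (f s, g s)"] that by (auto intro: continuous_on_Pair)
  show per: "?l y v = ?l y' v" if "torus_rel y y'" for y y' v
    using that by (simp flip: abs_torus_eq_iff)
  show conv: "convex_on UNIV (?l y)" for y
  proof (rule convex_onI)
    fix t :: real and u v :: "real ^ 'n" assume t: "0 < t" "t < 1"
    have "strictly_convex (L (abs_torus y))" using assms by (simp add: lagrangian_def)
    then show "?l y ((1 - t) *\<^sub>R u + t *\<^sub>R v) \<le> (1 - t) * ?l y u + t * ?l y v"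
      using t by (cases "u = v") (auto simp: strictly_convex_def less_imp_le algebra_simps simp flip: scaleR_add_left)
  qed simp
  show "\<exists>B. \<forall>y v. A * norm v - B \<le> ?l y v" for A
  proof -
    have local: "\<exists>U B. open U \<and> y0 \<in> U \<and> (\<forall>y\<in>U. \<forall>v. A * norm v - B \<le> ?l y v)" for y0
    proof -
      have "filterlim (\<lambda>v. ?l y0 v / norm v) at_top at_infinity"
        using assms by (simp add: lagrangian_def)
      then obtain r0 where r0: "\<And>v. r0 \<le> norm v \<Longrightarrow> A + 1 \<le> ?l y0 v / norm v"
        unfolding filterlim_at_top eventually_at_infinity by blast
      define r where "r = max 1 (max r0 (?l y0 0 + 1))"
      have r: "0 < r" "r0 \<le> r" "?l y0 0 < r" by (auto simp: r_def)
      let ?W = "{(y, w). A * r < ?l y w - ?l y 0}"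
      have W: "open ?W"
        unfolding case_prod_beta by (intro open_Collect_less continuous_intros cont2)
      have "{y0} \<times> sphere 0 r \<subseteq> ?W"
      proof safe
        fix w :: "real ^ 'n" assume "w \<in> sphere 0 r"
        then have w: "norm w = r" by simp
        then have "(A + 1) * r \<le> ?l y0 w" using r0[of w] r by (simp add: pos_le_divide_eq)
        then show "A * r < ?l y0 w - ?l y0 0" using r(3) by (simp add: distrib_right)
      qed
      from Elementary_Topology.tube_lemma[OF compact_sphere W this]
      obtain U where U: "y0 \<in> U" "open U" "U \<times> sphere 0 r \<subseteq> ?W" by blast
      let ?C = "cball y0 1 \<times> cball (0 :: real ^ 'n) r"
      have "compact ((\<lambda>(y, v). ?l y v) ` ?C)"
        by (intro compact_continuous_image compact_Times continuous_on_subset[OF cont]) auto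
      then have "bounded ((\<lambda>(y, v). ?l y v) ` ?C)" by (rule compact_imp_bounded)
      then obtain B where B: "\<forall>z\<in>(\<lambda>(y, v). ?l y v) ` ?C. norm z \<le> B"
        unfolding bounded_iff by (elim exE)
      have "A * norm v - (B + \<bar>A\<bar> * r) \<le> ?l y v" if y: "y \<in> U \<inter> ball y0 1" for y v
      proof (cases "norm v \<le> r")
        case True
        then have "\<bar>?l y v\<bar> \<le> B" using B y by (force simp: image_iff)
        moreover have "A * norm v \<le> \<bar>A\<bar> * r" using True by (intro mult_mono) auto
        ultimately show ?thesis by linarith
      next
        case False
        let ?t = "r / norm v"
        have "0 < norm v" using False r(1) by linarith
        then have t: "0 < ?t" "?t < 1" "?t * norm v = r" using False r(1) by (auto simp: field_simps)
        have "norm (?t *\<^sub>R v) = r" using t r(1) by (auto split: if_splits)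
        then have "(y, ?t *\<^sub>R v) \<in> ?W" using y by (intro subsetD[OF U(3)]) (simp del: norm_scaleR)
        then have "A * r < ?l y (?t *\<^sub>R v) - ?l y 0" by simp
        also have "?l y (?t *\<^sub>R v) \<le> (1 - ?t) * ?l y 0 + ?t * ?l y v"
          using convex_onD[OF conv, of ?t 0 v y] t by simp
        finally have "A * (?t * norm v) < ?t * (?l y v - ?l y 0)"
          unfolding t(3) by (simp add: algebra_simps)
        then have "?t * (A * norm v) < ?t * (?l y v - ?l y 0)" by (simp only: mult_ac)
        then have "A * norm v < ?l y v - ?l y 0" using t(1) by (simp only: mult_less_cancel_left_pos)
        moreover have "\<bar>?l y 0\<bar> \<le> B" using B y r(1) by (force simp: image_iff)
        moreover have "0 \<le> \<bar>A\<bar> * r" using r(1) by simp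
        ultimately show ?thesis by linarith
      qed
      then show ?thesis using U by (intro exI[of _ "U \<inter> ball y0 1"] exI[of _ "B + \<bar>A\<bar> * r"]) auto
    qed
    then obtain U B where UB: "\<And>y0. open (U y0)" "\<And>y0. y0 \<in> U y0"
      "\<And>y0 y v. y \<in> U y0 \<Longrightarrow> A * norm v - B y0 \<le> ?l y v"
      by metis
    let ?X = "cbox 0 One :: (real ^ 'n) set"
    obtain F where F: "F \<subseteq> ?X" "finite F" "?X \<subseteq> (\<Union>y\<in>F. U y)"
      by (rule compactE_image[of ?X ?X U]) (use UB in auto)
    have "A * norm v - (\<Sum>y\<in>F. \<bar>B y\<bar>) \<le> ?l y v" for y v
    proof -
      obtain z where z: "torus_rel z y" "z - 0 \<in> ?X" by (rule torus_rel_cube)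
      then obtain y0 where y0: "y0 \<in> F" "z \<in> U y0" using F(3) by auto
      have "B y0 \<le> (\<Sum>y\<in>F. \<bar>B y\<bar>)"
        using member_le_sum[OF y0(1), of "\<lambda>y. \<bar>B y\<bar>"] F(2) by auto
      then show ?thesis using UB(3)[OF y0(2), of v] per[OF z(1), of v] by linarith
    qed
    then show ?thesis by blast
  qed
qed

theorem theorem8p4:
  fixes L :: "'n::finite torus \<Rightarrow> real ^ 'n \<Rightarrow> real"
    and T :: real and Q :: "real ^ 'n"
  assumes "lagrangian L" and "T > 0"
  shows "\<exists>xstar :: 'n torus.
           minimax_mather L T Q (return borel xstar) \<and>
           gQ L T Q (return borel xstar) = (SUP \<theta>\<in>borel_probs. gQ L T Q \<theta>)"
proof -
  note pl = lagrangian_periodic[OF assms(1)]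
  interpret periodic_lagrangian "\<lambda>y v. L (abs_torus y) v" by (rule pl)
  obtain y0 where y0: "\<And>y. loop_cost T Q y \<le> loop_cost T Q y0"
    using loop_cost_attains_max[OF assms(2)] by blast
  have le: "gQ L T Q \<theta> \<le> gQ L T Q (return borel (abs_torus y0))" if \<theta>: "\<theta> \<in> borel_probs" for \<theta>
  proof -
    have "gQ L T Q \<theta> \<le> ereal (loop_cost T Q y0)"
    proof (rule ereal_le_epsilon2)
      fix e :: real assume "0 < e"
      then have "loop_cost T Q y < loop_cost T Q y0 + e" for y using y0[of y] by simp
      from gQ_le[OF pl assms(2) \<theta> this]
      show "gQ L T Q \<theta> \<le> ereal (loop_cost T Q y0) + ereal e" by simp
    qed
    also note gQ_ge[OF pl assms(2)]
    finally show ?thesis .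
  qed
  have prob: "return borel (abs_torus y0) \<in> borel_probs"
    by (simp add: borel_probs_def prob_space_return)
  show ?thesis
  proof (intro exI conjI)
    show "minimax_mather L T Q (return borel (abs_torus y0))"
      using le prob by (simp add: minimax_mather_def)
    show "gQ L T Q (return borel (abs_torus y0)) = (SUP \<theta>\<in>borel_probs. gQ L T Q \<theta>)"
      using le prob by (intro antisym SUP_upper SUP_least)
  qed
qed

end
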